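(* The minimization problem $$\text{find }\mathcal W_*\in\mathcal U_{\mathrm{ad}}\text{ such that }\mathcal J(\mathcal W_* )=\inf_{\mathcal W\in\mathcal U_{\mathrm{ad}}}\mathcal J(\mathcal W)$$ has at least one solution in $\mathcal U_{\mathrm{ad}}$. Moreover, let $\mathcal V\subset\mathcal U_{\mathrm{ad}}$ be a closed convex subset such that $$\|\delta Y(T,\cdot,\mathcal W)\|_{\mathbb L^2}^2>0\quad\text{for all }\mathcal W\in\mathcal V\text{ and all }\delta\mathcal W\neq0\text{ with }\mathcal W+\delta\mathcal W\in\mathcal V,$$ where $\delta Y(t,\cdot,\mathcal W):=Y(t,\cdot,\mathcal W+\delta\mathcal W)-Y(t,\cdot,\mathcal W)$. Then the minimization problem admits at most one solution in $\mathcal V$.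
   Context: Fix $T>0$, $l>0$. All spaces are real. Let $\mathbb L^2:=L^2(0,l)\times\mathbb R^2$ with $\langle (y,a,b),(z,c,d)\rangle_{\mathbb L^2}=\langle y,z\rangle_{L^2(0,l)}+ac+bd$, and $\mathbb L^2_T:=L^2((0,T)\times(0,l))\times L^2(0,T)$ with $\langle (y,y_1),(z,z_1)\rangle_{\mathbb L^2_T}=\langle y,z\rangle_{L^2((0,T)\times(0,l))}+\langle y_1,z_1\rangle_{L^2(0,T)}$. For $k=1,2$ let $\mathbb H^k:=\{(u,u(0),u(l)) : u\in H^k(0,l)\}$ with the product norm of $H^k(0,l)\times\mathbb R^2$, and let $\mathcal H_{\mathrm{en}}:=\mathbb H^1\times\mathbb L^2$. Direct problem: for fixed initial data $(Y_0,Y_1)=((y_0,a,b),(y_1,c,d))\in\mathcal H_{\mathrm{en}}$ and a source $\mathcal W=(F,G)\in\mathbb L^2_T$, $Y(t,\cdot,\mathcal W)=(y(t,\cdot),y(t,0),y(t,l))$ denotes the mild solution of $$\begin{cases} y_{tt}-y_{xx}=F(t,x) & \text{in }(0,T)\times(0,l),\\ y_{tt}(t,0)-y_x(t,0)=G(t) & \text{in }(0,T),\\ y_{tt}(t,l)+y_x(t,l)=0 & \text{in }(0,T),\\ (y(0,\cdot),y(0,0),y(0,l))=(y_0,a,b),\quad (y_t(0,\cdot),y_t(0,0),y_t(0,l))=(y_1,c,d).\end{cases}$$ Mild solutions: the operator $\mathcal A=\begin{pmatrix}0&I\\ \mathcal B&0\end{pmatrix}$ with $D(\mathcal A)=\mathbb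 H^2\times\mathbb H^1$ and $\mathcal B(u,u(0),u(l))=(u_{xx},u_x(0),-u_x(l))$, $D(\mathcal B)=\mathbb H^2$, generates a strongly continuous group $(e^{t\mathcal A})_{t\in\mathbb R}$ on $\mathcal H_{\mathrm{en}}$. The mild solution is given by $(Y(t),Y_t(t))=e^{t\mathcal A}(Y_0,Y_1)+\int_0^t e^{(t-s)\mathcal A}(0,0,0,F(s,\cdot),G(s),0)\,ds$; it satisfies $Y\in C([0,T];\mathbb H^1)\cap C^1([0,T];\mathbb L^2)$. Admissible set: given real constants $F_*\le F^*$, $G_*\le G^*$, $\mathcal U_{\mathrm{ad}}:=\{(F,G)\in\mathbb L^2_T : F_*\le F(t,x)\le F^* \text{ for a.e. }(t,x),\ G_*\le G(t)\le G^*\text{ for a.e. }t\}$. Cost functional: given a (noisy) datum $Y_T^\delta\in\mathbb L^2$, $\mathcal J(\mathcal W):=\frac12\|Y(T,\cdot,\mathcal W)-Y_T^\delta\|_{\mathbb L^2}^2$ for $\mathcal W\in\mathcal U_{\mathrm{ad}}$. *)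

theory Defs
  imports "HOL-Analysis.Analysis"
begin

section \<open>The Hilbert space of square-integrable functions on a Euclidean space\<close>

definition square_integrable :: "('a::euclidean_space \<Rightarrow> real) \<Rightarrow> bool" where
  "square_integrable f \<longleftrightarrow> f \<in> borel_measurable lborel \<and> integrable lborel (\<lambda>x. (f x)\<^sup>2)"

lemma square_integrable_mult:
  assumes "square_integrable f" "square_integrable g"
  shows "integrable lborel (\<lambda>x. f x * g x)"
proof -
  have [measurable]: "f \<in> borel_measurable borel" "g \<in> borel_measurable borel"
    using assms by (auto simp: square_integrable_def)
  have "integrable lborel (\<lambda>x. (f x)\<^sup>2 + (g x)\<^sup>2)"
    using assms by (auto simp: square_integrable_def)
  then show ?thesis
  proof (rule Bochner_Integration.integrable_bound)
    have "\<bar>a * b\<bar> \<le> a\<^sup>2 + b\<^sup>2" for a b :: real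
      using sum_squares_bound[of "\<bar>a\<bar>" "\<bar>b\<bar>"] mult_nonneg_nonneg[of "\<bar>a\<bar>" "\<bar>b\<bar>"]
      unfolding abs_mult power2_abs by linarith
    then show "AE x in lborel. norm (f x * g x) \<le> norm ((f x)\<^sup>2 + (g x)\<^sup>2)"
      by auto
  qed measurable
qed

lemma square_integrable_zero [simp]: "square_integrable (\<lambda>_. 0)"
  by (simp add: square_integrable_def)

lemma square_integrable_add:
  assumes "square_integrable f" "square_integrable g"
  shows "square_integrable (\<lambda>x. f x + g x)"
  using assms square_integrable_mult[OF assms]
  by (auto simp: square_integrable_def power2_sum mult.assoc)

lemma square_integrable_scale:
  assumes "square_integrable f"
  shows "square_integrable (\<lambda>x. c * f x)"
  using assms by (auto simp: square_integrable_def power_mult_distrib)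

lemma square_integrable_uminus:
  assumes "square_integrable f"
  shows "square_integrable (\<lambda>x. - f x)"
  using square_integrable_scale[OF assms, of "-1"] by simp

lemma square_integrable_diff:
  assumes "square_integrable f" "square_integrable g"
  shows "square_integrable (\<lambda>x. f x - g x)"
  using square_integrable_add[OF assms(1) square_integrable_uminus[OF assms(2)]] by simp

definition l2_rel :: "('a::euclidean_space \<Rightarrow> real) \<Rightarrow> ('a \<Rightarrow> real) \<Rightarrow> bool" where
  "l2_rel f g \<longleftrightarrow> square_integrable f \<and> square_integrable g \<and> (AE x in lborel. f x = g x)"

quotient_type (overloaded) 'a l2 = "'a::euclidean_space \<Rightarrow> real" / partial: l2_rel
proof (rule part_equivpI)
  show "\<exists>f. l2_rel f f"
    by (rule exI[of _ "\<lambda>_. 0"]) (simp add: l2_rel_def)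
  show "symp l2_rel"
    by (rule sympI) (auto simp: l2_rel_def)
  show "transp l2_rel"
    by (rule transpI) (auto simp: l2_rel_def elim: eventually_elim2)
qed

instantiation l2 :: (euclidean_space) real_inner
begin

lift_definition zero_l2 :: "'a l2" is "\<lambda>_. 0"
  by (simp add: l2_rel_def)

lift_definition plus_l2 :: "'a l2 \<Rightarrow> 'a l2 \<Rightarrow> 'a l2" is "\<lambda>f g x. f x + g x"
  by (auto simp: l2_rel_def square_integrable_add elim: eventually_elim2)

lift_definition uminus_l2 :: "'a l2 \<Rightarrow> 'a l2" is "\<lambda>f x. - f x"
  by (auto simp: l2_rel_def square_integrable_uminus)

lift_definition minus_l2 :: "'a l2 \<Rightarrow> 'a l2 \<Rightarrow> 'a l2" is "\<lambda>f g x. f x - g x"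
  by (auto simp: l2_rel_def square_integrable_diff elim: eventually_elim2)

lift_definition scaleR_l2 :: "real \<Rightarrow> 'a l2 \<Rightarrow> 'a l2" is "\<lambda>c f x. c * f x"
  by (auto simp: l2_rel_def square_integrable_scale)

lift_definition inner_l2 :: "'a l2 \<Rightarrow> 'a l2 \<Rightarrow> real" is "\<lambda>f g. LINT x|lborel. f x * g x"
  unfolding l2_rel_def square_integrable_def
  by (intro integral_cong_AE) (auto elim: eventually_elim2)

definition norm_l2 :: "'a l2 \<Rightarrow> real" where
  "norm_l2 u = sqrt (inner u u)"

definition sgn_l2 :: "'a l2 \<Rightarrow> 'a l2" where
  "sgn_l2 u = scaleR (inverse (norm u)) u"

definition dist_l2 :: "'a l2 \<Rightarrow> 'a l2 \<Rightarrow> real" where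
  "dist_l2 u v = norm (u - v)"

definition uniformity_l2 :: "('a l2 \<times> 'a l2) filter" where
  "uniformity_l2 = (INF e\<in>{0<..}. principal {(x, y). dist x y < e})"

definition open_l2 :: "'a l2 set \<Rightarrow> bool" where
  "open_l2 U \<longleftrightarrow> (\<forall>x\<in>U. eventually (\<lambda>(x', y). x' = x \<longrightarrow> y \<in> U) uniformity)"

instance
proof
  fix u v w :: "'a l2" and a b :: real and U :: "'a l2 set"
  show "u + v + w = u + (v + w)"
    by transfer (auto simp: l2_rel_def algebra_simps intro!: square_integrable_add)
  show "u + v = v + u"
    by transfer (auto simp: l2_rel_def algebra_simps intro!: square_integrable_add)
  show "0 + u = u"
    by transfer (auto simp: l2_rel_def)
  show "- u + u = 0"
    by transfer (auto simp: l2_rel_def)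
  show "u - v = u + - v"
    by transfer (auto simp: l2_rel_def intro!: square_integrable_diff)
  show "a *\<^sub>R (u + v) = a *\<^sub>R u + a *\<^sub>R v"
    by transfer (auto simp: l2_rel_def algebra_simps
        intro!: square_integrable_add square_integrable_scale)
  show "(a + b) *\<^sub>R u = a *\<^sub>R u + b *\<^sub>R u"
    by transfer (auto simp: l2_rel_def algebra_simps
        intro!: square_integrable_add square_integrable_scale)
  show "a *\<^sub>R b *\<^sub>R u = (a * b) *\<^sub>R u"
    by transfer (auto simp: l2_rel_def algebra_simps square_integrable_scale)
  show "1 *\<^sub>R u = u"
    by transfer (auto simp: l2_rel_def)
  show "sgn u = scaleR (inverse (norm u)) u"
    by (rule sgn_l2_def)
  show "dist u v = norm (u - v)"
    by (rule dist_l2_def)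
  show "uniformity = (INF e\<in>{0<..}. principal {(x, y :: 'a l2). dist x y < e})"
    by (rule uniformity_l2_def)
  show "open U \<longleftrightarrow> (\<forall>x\<in>U. eventually (\<lambda>(x', y). x' = x \<longrightarrow> y \<in> U) uniformity)"
    by (rule open_l2_def)
  show "inner u v = inner v u"
    by transfer (simp add: mult.commute)
  show "inner (u + v) w = inner u w + inner v w"
    by transfer (auto simp: l2_rel_def distrib_right square_integrable_mult)
  show "inner (a *\<^sub>R u) v = a * inner u v"
    by transfer (auto simp: l2_rel_def mult.assoc)
  show "0 \<le> inner u u"
    by transfer auto
  show "inner u u = 0 \<longleftrightarrow> u = 0"
  proof transfer
    fix f :: "'a \<Rightarrow> real"
    assume f: "l2_rel f f"
    then have "integrable lborel (\<lambda>x. f x * f x)"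
      by (simp add: l2_rel_def square_integrable_mult)
    then have "(LINT x|lborel. f x * f x) = 0 \<longleftrightarrow> (AE x in lborel. f x * f x = 0)"
      by (intro integral_nonneg_eq_0_iff_AE) auto
    with f show "(LINT x|lborel. f x * f x) = 0 \<longleftrightarrow> l2_rel f (\<lambda>_. 0)"
      by (simp add: l2_rel_def)
  qed
  show "norm u = sqrt (inner u u)"
    by (rule norm_l2_def)
qed

end

text \<open>The class of a function, with value \<open>0\<close> on functions that are not square-integrable.\<close>

definition to_l2 :: "('a::euclidean_space \<Rightarrow> real) \<Rightarrow> 'a l2" where
  "to_l2 f = (if square_integrable f then abs_l2 f else 0)"

lemma square_integrable_rep: "square_integrable (rep_l2 u)"
  using Quotient_rep_reflp[OF Quotient_l2, of u] by (simp add: l2_rel_def)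

lemma to_l2_rep [simp]: "to_l2 (rep_l2 u) = u"
  using Quotient_abs_rep[OF Quotient_l2, of u] by (simp add: to_l2_def square_integrable_rep)

lemma rep_to_l2:
  assumes "square_integrable f"
  shows "AE x in lborel. rep_l2 (to_l2 f) x = f x"
  using Quotient3_rep_abs[OF Quotient3_l2, of f] assms
  by (simp add: l2_rel_def to_l2_def)

lemma to_l2_eq_iff:
  assumes "square_integrable f" "square_integrable g"
  shows "to_l2 f = to_l2 g \<longleftrightarrow> (AE x in lborel. f x = g x)"
  using assms Quotient3_rel[OF Quotient3_l2, of f g] by (simp add: to_l2_def l2_rel_def)

lemma to_l2_zero: "to_l2 (\<lambda>_. 0) = 0"
  by (simp add: to_l2_def zero_l2.abs_eq)

lemma to_l2_add:
  assumes "square_integrable f" "square_integrable g"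
  shows "to_l2 (\<lambda>x. f x + g x) = to_l2 f + to_l2 g"
  using assms by (simp add: to_l2_def square_integrable_add plus_l2.abs_eq l2_rel_def)

lemma to_l2_diff:
  assumes "square_integrable f" "square_integrable g"
  shows "to_l2 (\<lambda>x. f x - g x) = to_l2 f - to_l2 g"
  using assms by (simp add: to_l2_def square_integrable_diff minus_l2.abs_eq l2_rel_def)

lemma to_l2_scale:
  assumes "square_integrable f"
  shows "to_l2 (\<lambda>x. c * f x) = c *\<^sub>R to_l2 f"
  using assms by (simp add: to_l2_def square_integrable_scale scaleR_l2.abs_eq l2_rel_def)

lemma inner_to_l2:
  assumes "square_integrable f" "square_integrable g"
  shows "inner (to_l2 f) (to_l2 g) = (LINT x|lborel. f x * g x)"
  using assms by (simp add: to_l2_def inner_l2.abs_eq l2_rel_def)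

lemma norm_to_l2:
  assumes "square_integrable f"
  shows "norm (to_l2 f) = sqrt (LINT x|lborel. (f x)\<^sup>2)"
  by (simp add: norm_l2_def inner_to_l2 assms power2_eq_square)


lemma l2_cases:
  obtains f where "square_integrable f" "u = to_l2 f"
  using square_integrable_rep to_l2_rep by metis

lemma norm_to_l2_ennreal:
  assumes "square_integrable f"
  shows "(\<integral>\<^sup>+x. ennreal ((f x)\<^sup>2) \<partial>lborel) = ennreal ((norm (to_l2 f))\<^sup>2)"
  using assms
  by (subst nn_integral_eq_integral)
     (auto simp: norm_to_l2 square_integrable_def integral_nonneg_AE)

lemma square_integrableI_nn:
  assumes "f \<in> borel_measurable borel" "(\<integral>\<^sup>+x. ennreal ((f x)\<^sup>2) \<partial>lborel) < \<infinity>"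
  shows "square_integrable f"
  using assms by (auto simp: square_integrable_def intro!: integrableI_bounded)

subsection \<open>Completeness\<close>

lemma Cauchy_fast_subseq:
  fixes X :: "nat \<Rightarrow> 'a::metric_space" and e :: "nat \<Rightarrow> real"
  assumes "Cauchy X" "\<And>n. 0 < e n"
  obtains r where "strict_mono r" "\<And>n m. n \<le> m \<Longrightarrow> dist (X (r n)) (X (r m)) < e n"
proof -
  have "\<exists>N. \<forall>i\<ge>N. \<forall>j\<ge>N. dist (X i) (X j) < e n" for n
    using assms unfolding Cauchy_def by blast
  then obtain N where N: "\<And>n i j. N n \<le> i \<Longrightarrow> N n \<le> j \<Longrightarrow> dist (X i) (X j) < e n"
    by metis
  define r where "r = rec_nat (N 0) (\<lambda>n k. max (N (Suc n)) (Suc k))"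
  have r_Suc: "r (Suc n) = max (N (Suc n)) (Suc (r n))" for n
    by (simp add: r_def)
  have sm: "strict_mono r"
    by (simp add: strict_mono_Suc_iff r_Suc less_max_iff_disj)
  have ge: "N n \<le> r n" for n
    by (cases n) (simp_all add: r_def)
  show thesis
  proof (rule that[OF sm])
    fix n m :: nat assume "n \<le> m"
    then have "r n \<le> r m" using sm by (simp add: strict_mono_less_eq)
    then show "dist (X (r n)) (X (r m)) < e n"
      using N[of n "r n" "r m"] ge[of n] by simp
  qed
qed

instance l2 :: (euclidean_space) complete_space
proof
  fix X :: "nat \<Rightarrow> 'a l2"
  assume "Cauchy X"
  then obtain r where r: "strict_mono r"
    "\<And>n m. n \<le> m \<Longrightarrow> dist (X (r n)) (X (r m)) < (1/4) ^ n"
    by (rule Cauchy_fast_subseq[where e = "\<lambda>n. (1/4) ^ n"]) auto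
  define f where "f n = rep_l2 (X (r n))" for n
  have sq: "square_integrable (f n)" for n
    by (simp add: f_def square_integrable_rep)
  then have [measurable]: "f n \<in> borel_measurable borel" for n
    by (simp add: square_integrable_def)
  have Xf: "X (r n) = to_l2 (f n)" for n
    by (simp add: f_def)
  have nn: "(\<integral>\<^sup>+x. ennreal ((f n x - f m x)\<^sup>2) \<partial>lborel) \<le> ennreal ((1/16) ^ n)"
    if "n \<le> m" for n m
  proof -
    have "norm (to_l2 (\<lambda>x. f n x - f m x)) \<le> (1/4) ^ n"
      using r(2)[OF that] by (simp add: to_l2_diff sq Xf dist_norm)
    then have "(norm (to_l2 (\<lambda>x. f n x - f m x)))\<^sup>2 \<le> ((1/4) ^ n)\<^sup>2"
      by (intro power_mono) auto
    also have "((1/4) ^ n)\<^sup>2 = (1/16 :: real) ^ n"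
      by (simp add: power2_eq_square flip: power_mult_distrib)
    finally show ?thesis
      by (simp add: norm_to_l2_ennreal square_integrable_diff sq ennreal_leI)
  qed
  let ?d = "\<lambda>n x. 4 ^ n * (f n x - f (Suc n) x)\<^sup>2"
  have "(\<integral>\<^sup>+x. (\<Sum>n. ennreal (?d n x)) \<partial>lborel) = (\<Sum>n. \<integral>\<^sup>+x. ennreal (?d n x) \<partial>lborel)"
    by (intro nn_integral_suminf) measurable
  also have "\<dots> \<le> (\<Sum>n. ennreal ((1/4) ^ n))"
  proof (intro suminf_le summableI)
    fix n
    have "(\<integral>\<^sup>+x. ennreal (?d n x) \<partial>lborel)
        = ennreal (4 ^ n) * (\<integral>\<^sup>+x. ennreal ((f n x - f (Suc n) x)\<^sup>2) \<partial>lborel)"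
      by (subst nn_integral_cmult[symmetric]) (auto simp: ennreal_mult)
    also have "\<dots> \<le> ennreal (4 ^ n) * ennreal ((1/16) ^ n)"
      by (intro mult_left_mono nn) auto
    also have "\<dots> = ennreal ((1/4) ^ n)"
      by (subst ennreal_mult[symmetric]) (auto simp flip: power_mult_distrib)
    finally show "(\<integral>\<^sup>+x. ennreal (?d n x) \<partial>lborel) \<le> ennreal ((1/4) ^ n)" .
  qed
  also have "\<dots> < \<infinity>"
    by (subst suminf_ennreal2) (auto intro!: summable_geometric simp: ennreal_less_top)
  finally have "AE x in lborel. (\<Sum>n. ennreal (?d n x)) \<noteq> \<infinity>"
    by (intro nn_integral_PInf_AE) auto
  then have ae: "AE x in lborel. convergent (\<lambda>n. f n x)"
  proof eventually_elim
    case (elim x)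
    then have "summable (\<lambda>n. ?d n x)"
      by (intro summable_suminf_not_top) auto
    then have "(\<lambda>n. ?d n x) \<longlonglongrightarrow> 0"
      by (rule summable_LIMSEQ_zero)
    then have "Bseq (\<lambda>n. ?d n x)"
      by (intro convergent_imp_Bseq) (auto simp: convergent_def)
    then obtain K where K: "K > 0" "\<And>n. ?d n x \<le> K"
      by (auto simp: Bseq_def)
    have "\<bar>f (Suc n) x - f n x\<bar> \<le> sqrt K * (1/2) ^ n" for n
    proof -
      have "((2 :: real) ^ n)\<^sup>2 = 4 ^ n"
        by (simp add: power2_eq_square flip: power_mult_distrib)
      then have "(2 ^ n * \<bar>f (Suc n) x - f n x\<bar>)\<^sup>2 = ?d n x"
        by (simp add: power_mult_distrib power2_commute[of "f n x"])
      then have "2 ^ n * \<bar>f (Suc n) x - f n x\<bar> \<le> sqrt K"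
        using K(2)[of n] by (intro real_le_rsqrt) simp
      then show ?thesis by (simp add: field_simps)
    qed
    moreover have "summable (\<lambda>n. sqrt K * (1/2 :: real) ^ n)"
      by (rule summable_mult) (rule summable_geometric, simp)
    ultimately have "summable (\<lambda>n. f (Suc n) x - f n x)"
      by - (rule summable_comparison_test'[where N = 0], assumption, simp)
    then have "convergent (\<lambda>n. \<Sum>i<n. f (Suc i) x - f i x)"
      by (simp add: summable_iff_convergent)
    then have "convergent (\<lambda>n. f n x - f 0 x)"
      by (simp only: sum_lessThan_telescope[of "\<lambda>n. f n x"])
    then have "convergent (\<lambda>n. (f n x - f 0 x) + f 0 x)"
      by (intro convergent_add convergent_const)
    then show ?case by simp
  qed
  define g where "g x = lim (\<lambda>n. f n x)" for x
  have [measurable]: "g \<in> borel_measurable borel"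
    unfolding g_def by measurable
  have bound: "(\<integral>\<^sup>+x. ennreal ((f n x - g x)\<^sup>2) \<partial>lborel) \<le> ennreal ((1/16) ^ n)" for n
  proof -
    have "(\<integral>\<^sup>+x. ennreal ((f n x - g x)\<^sup>2) \<partial>lborel)
        = (\<integral>\<^sup>+x. liminf (\<lambda>m. ennreal ((f n x - f m x)\<^sup>2)) \<partial>lborel)"
    proof (rule nn_integral_cong_AE)
      show "AE x in lborel. ennreal ((f n x - g x)\<^sup>2)
          = liminf (\<lambda>m. ennreal ((f n x - f m x)\<^sup>2))"
        using ae
      proof eventually_elim
        case (elim x)
        then have "(\<lambda>m. f m x) \<longlonglongrightarrow> g x"
          by (simp add: g_def convergent_LIMSEQ_iff)
        then have "(\<lambda>m. ennreal ((f n x - f m x)\<^sup>2)) \<longlonglongrightarrow> ennreal ((f n x - g x)\<^sup>2)"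
          by (intro tendsto_intros)
        from lim_imp_Liminf[OF trivial_limit_sequentially this] show ?case
          by simp
      qed
    qed
    also have "\<dots> \<le> liminf (\<lambda>m. \<integral>\<^sup>+x. ennreal ((f n x - f m x)\<^sup>2) \<partial>lborel)"
      by (intro nn_integral_liminf) measurable
    also have "\<dots> \<le> ennreal ((1/16) ^ n)"
    proof (rule Liminf_le)
      show "\<forall>\<^sub>F m in sequentially. 
          (\<integral>\<^sup>+x. ennreal ((f n x - f m x)\<^sup>2) \<partial>lborel) \<le> ennreal ((1/16) ^ n)"
        using eventually_ge_at_top[of n] by eventually_elim (rule nn)
    qed simp
    finally show ?thesis .
  qed
  have sqd: "square_integrable (\<lambda>x. f n x - g x)" for n
    using le_less_trans[OF bound[of n] ennreal_less_top] by (intro square_integrableI_nn) simp_all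
  have sqg: "square_integrable g"
    using square_integrable_diff[OF sq sqd, of 0 0] by simp
  have "(norm (X (r n) - to_l2 g))\<^sup>2 \<le> (1/16) ^ n" for n
    using bound[of n] by (simp add: Xf norm_to_l2_ennreal[OF sqd] to_l2_diff sq sqg)
  moreover have "(\<lambda>n. (1/16 :: real) ^ n) \<longlonglongrightarrow> 0"
    by (intro LIMSEQ_power_zero) auto
  ultimately have "(\<lambda>n. (norm (X (r n) - to_l2 g))\<^sup>2) \<longlonglongrightarrow> 0"
    by - (rule tendsto_sandwich[OF _ _ tendsto_const, where h = "\<lambda>n. (1/16) ^ n"], auto)
  then have "(\<lambda>n. sqrt ((norm (X (r n) - to_l2 g))\<^sup>2)) \<longlonglongrightarrow> sqrt 0"
    by (rule tendsto_real_sqrt)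
  then have "(X \<circ> r) \<longlonglongrightarrow> to_l2 g"
    by (subst LIM_zero_iff[symmetric]) (simp add: tendsto_norm_zero_iff)
  then have "X \<longlonglongrightarrow> to_l2 g"
    by (rule Cauchy_converges_subseq[OF \<open>Cauchy X\<close> r(1)])
  then show "convergent X"
    by (auto simp: convergent_def)
qed

instance l2 :: (euclidean_space) banach ..

subsection \<open>Separability\<close>

lemma to_l2_sum:
  assumes "finite I" "\<And>i. i \<in> I \<Longrightarrow> square_integrable (f i)"
  shows "square_integrable (\<lambda>x. \<Sum>i\<in>I. f i x) \<and>
    to_l2 (\<lambda>x. \<Sum>i\<in>I. f i x) = (\<Sum>i\<in>I. to_l2 (f i))"
  using assms by (induction I) (auto simp: to_l2_zero to_l2_add square_integrable_add)

lemma square_integrable_indicator: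
  assumes "A \<in> sets borel" "emeasure lborel A < \<infinity>"
  shows "square_integrable (indicat_real A)"
proof (rule square_integrableI_nn)
  have "(\<lambda>x. ennreal ((indicat_real A x)\<^sup>2)) = indicator A"
    by (auto simp: fun_eq_iff indicator_def)
  with assms show "(\<integral>\<^sup>+x. ennreal ((indicat_real A x)\<^sup>2) \<partial>lborel) < \<infinity>"
    by simp
qed (use assms in measurable)

lemma dense_imp_countable_subbasis:
  fixes D :: "'a::metric_space set"
  assumes "countable D" "closure D = UNIV"
  shows "\<exists>B :: 'a set set. countable B \<and> open = generate_topology B"
proof -
  let ?B = "(\<lambda>(d, n). ball d (1 / real (Suc n))) ` (D \<times> UNIV)"
  have "topological_basis ?B"
  proof (rule topological_basisI)
    fix U :: "'a set" and x assume "open U" "x \<in> U"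
    then obtain e where e: "e > 0" "ball x e \<subseteq> U"
      by (auto elim: openE)
    obtain n where n: "1 / real (Suc n) < e / 2"
      using \<open>e > 0\<close> nat_approx_posE[of "e / 2"] by auto
    have "x \<in> closure D"
      using assms by simp
    then obtain d where d: "d \<in> D" "dist d x < 1 / real (Suc n)"
      using closure_approachable[of x D] by (meson of_nat_0_less_iff zero_less_Suc zero_less_divide_1_iff)
    have "ball d (1 / real (Suc n)) \<subseteq> ball x e"
    proof
      fix y assume "y \<in> ball d (1 / real (Suc n))"
      then have "dist x y < 1 / real (Suc n) + 1 / real (Suc n)"
        using d dist_triangle[of x y d] dist_commute[of x d] unfolding mem_ball by linarith
      with n show "y \<in> ball x e" by simp
    qed
    with e d show "\<exists>b\<in>?B. x \<in> b \<and> b \<subseteq> U"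
      by (intro bexI[of _ "ball d (1 / real (Suc n))"]) auto
  qed auto
  moreover have "countable ?B"
    using assms by auto
  ultimately show ?thesis
    using topological_basis_imp_subbasis by blast
qed

lemma countable_dense_of_span:
  fixes E :: "'a::real_normed_vector set"
  assumes "countable E" "closure (span E) = UNIV"
  shows "\<exists>D :: 'a set. countable D \<and> closure D = UNIV"
proof -
  define D where
    "D = (\<lambda>xs. \<Sum>(q, v)\<leftarrow>xs. real_of_rat q *\<^sub>R v) ` lists ((UNIV :: rat set) \<times> E)"
  have D0: "0 \<in> D"
    unfolding D_def by (rule image_eqI[of _ _ "[]"]) auto
  have Dstep: "real_of_rat q *\<^sub>R v + w \<in> D" if "v \<in> E" "w \<in> D" for q v w
  proof -
    from that obtain xs where "xs \<in> lists (UNIV \<times> E)" "w = (\<Sum>(q, v)\<leftarrow>xs. real_of_rat q *\<^sub>R v)"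
      by (auto simp: D_def)
    with that show ?thesis
      unfolding D_def by (intro image_eqI[of _ _ "(q, v) # xs"]) auto
  qed
  have "w \<in> closure D" if "w \<in> span E" for w
    using that
  proof (induction rule: span_induct_alt)
    case base
    show ?case using D0 closure_subset by blast
  next
    case (step c v w)
    obtain y where y: "\<And>n. y n \<in> D" "y \<longlonglongrightarrow> w"
      using step(2) by (auto simp: closure_sequential)
    have "\<exists>q. \<bar>real_of_rat q - c\<bar> < 1 / real (Suc n)" for n
      using of_rat_dense[of "c - 1 / real (Suc n)" "c + 1 / real (Suc n)"]
      by (auto simp: abs_less_iff algebra_simps)
    then obtain q where q: "\<And>n. \<bar>real_of_rat (q n) - c\<bar> < 1 / real (Suc n)"
      by metis
    have "(\<lambda>n. real_of_rat (q n)) \<longlonglongrightarrow> c"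
    proof (rule LIM_zero_cancel, rule tendsto_rabs_zero_cancel,
        rule tendsto_sandwich[OF _ _ tendsto_const])
      show "(\<lambda>n. 1 / real (Suc n)) \<longlonglongrightarrow> 0"
        by (rule lim_1_over_real_power[of 1, simplified, THEN LIMSEQ_Suc])
    qed (use q in \<open>auto intro!: always_eventually less_imp_le\<close>)
    then have "(\<lambda>n. real_of_rat (q n) *\<^sub>R v + y n) \<longlonglongrightarrow> c *\<^sub>R v + w"
      by (intro tendsto_intros y)
    moreover have "real_of_rat (q n) *\<^sub>R v + y n \<in> D" for n
      using Dstep step y by auto
    ultimately show ?case
      unfolding closure_sequential by (intro exI[of _ "\<lambda>n. real_of_rat (q n) *\<^sub>R v + y n"]) auto
  qed
  then have "closure (span E) \<subseteq> closure D"
    by (intro closure_minimal) auto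
  then have "closure D = UNIV"
    using assms by auto
  moreover have "countable D"
    unfolding D_def using assms by (intro countable_image countable_lists) auto
  ultimately show ?thesis by blast
qed

lemma indicator_in_closure:
  fixes B :: "'a::euclidean_space set set"
  assumes "countable B" "topological_basis B"
  assumes A: "A \<in> sets borel" "emeasure lborel A < \<infinity>"
  shows "to_l2 (indicat_real A) \<in> closure ((\<lambda>F. to_l2 (indicat_real (\<Union>F))) `
    {F. finite F \<and> F \<subseteq> B \<and> emeasure lborel (\<Union>F) < \<infinity>})" (is "_ \<in> closure (?h ` ?F)")
  unfolding closure_approachable
proof (intro allI impI)
  fix e :: real assume "e > 0"
  obtain U where U: "open U" "A \<subseteq> U" "emeasure lborel (U - A) < ennreal (e\<^sup>2 / 2)"
    using outer_regular_lborel[OF A(1), of "e\<^sup>2 / 2"] \<open>e > 0\<close> by auto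
  have [measurable]: "A \<in> sets borel" "U \<in> sets borel"
    using U A by auto
  have "emeasure lborel U = emeasure lborel A + emeasure lborel (U - A)"
    using U(2) by (subst plus_emeasure) (auto intro!: arg_cong[where f = "emeasure lborel"])
  then have fU: "emeasure lborel U < \<infinity>"
    using A U(3) by (auto simp: ennreal_add_less_top intro: less_trans)
  obtain B' where B': "B' \<subseteq> B" "\<Union>B' = U"
    using assms(2) U(1) unfolding topological_basis_def by blast
  have oB: "open b" if "b \<in> B'" for b
    using that B' assms(2) topological_basis_open by blast
  obtain W where W: "\<And>n :: nat. finite (W n)" "\<And>n. W n \<subseteq> B'" "incseq (\<lambda>n. \<Union>(W n))" "(\<Union>n. \<Union>(W n)) = U"
  proof (cases "B' = {}")
    case True
    then show ?thesis using that[of "\<lambda>_. {}"] B' by (auto simp: incseq_def)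
  next
    case False
    have "countable B'" using B' assms(1) countable_subset by blast
    then have r: "range (from_nat_into B') = B'"
      using False by simp
    show ?thesis
    proof (rule that[of "\<lambda>n. from_nat_into B' ` {..<n}"])
      show "(\<Union>n. \<Union>(from_nat_into B' ` {..<n})) = U"
      proof -
        have "(\<Union>n. \<Union>(from_nat_into B' ` {..<n})) = \<Union>(range (from_nat_into B'))"
          by (auto intro: lessI)
        then show ?thesis using r B' by simp
      qed
      show "incseq (\<lambda>n. \<Union>(from_nat_into B' ` {..<n}))"
        unfolding incseq_def by (intro allI impI Union_mono image_mono) auto
    qed (use r in auto)
  qed
  have [measurable]: "\<Union>(W n) \<in> sets borel" for n
    using W oB by (intro borel_open open_Union) blast
  have subU: "\<Union>(W n) \<subseteq> U" for n
    using W(4) by auto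
  have "(\<lambda>n. emeasure lborel (U - \<Union>(W n))) \<longlonglongrightarrow> emeasure lborel (\<Inter>n. U - \<Union>(W n))"
  proof (rule Lim_emeasure_decseq)
    show "decseq (\<lambda>n. U - \<Union>(W n))"
      using W(3) by (fastforce simp: incseq_def decseq_def)
    show "emeasure lborel (U - \<Union>(W n)) \<noteq> \<infinity>" for n
      using fU emeasure_mono[of "U - \<Union>(W n)" U lborel] by (auto simp: top.extremum_strict dest: top.extremum_uniqueI)
  qed auto
  moreover have "(\<Inter>n. U - \<Union>(W n)) = {}"
    using W(4) by auto
  ultimately have "(\<lambda>n. emeasure lborel (U - \<Union>(W n))) \<longlonglongrightarrow> 0"
    by (simp only: emeasure_empty)
  then have "\<forall>\<^sub>F n in sequentially. emeasure lborel (U - \<Union>(W n)) < ennreal (e\<^sup>2 / 2)"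
    using \<open>e > 0\<close> by (intro order_tendstoD) auto
  then obtain n where n: "emeasure lborel (U - \<Union>(W n)) < ennreal (e\<^sup>2 / 2)"
    by (auto simp: eventually_sequentially)
  have fW: "emeasure lborel (\<Union>(W n)) < \<infinity>"
    by (rule le_less_trans[OF emeasure_mono[OF subU] fU]) simp
  let ?w = "indicat_real (\<Union>(W n))" and ?a = "indicat_real A"
  have sq: "square_integrable ?w" "square_integrable ?a"
    using fW A by (auto intro!: square_integrable_indicator)
  have "ennreal ((norm (to_l2 ?w - to_l2 ?a))\<^sup>2) = (\<integral>\<^sup>+x. ennreal ((?w x - ?a x)\<^sup>2) \<partial>lborel)"
    using sq by (simp add: norm_to_l2_ennreal square_integrable_diff to_l2_diff)
  also have "\<dots> \<le> (\<integral>\<^sup>+x. indicator (U - A) x + indicator (U - \<Union>(W n)) x \<partial>lborel)"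
    using subU[of n] U(2) by (intro nn_integral_mono) (auto simp: indicator_def)
  also have "\<dots> = emeasure lborel (U - A) + emeasure lborel (U - \<Union>(W n))"
    by (subst nn_integral_add) auto
  also have "\<dots> < ennreal (e\<^sup>2 / 2) + ennreal (e\<^sup>2 / 2)"
    using U(3) n by (rule add_strict_mono)
  also have "\<dots> = ennreal (e\<^sup>2)"
    by (subst ennreal_plus[symmetric]) auto
  finally have "(norm (to_l2 ?w - to_l2 ?a))\<^sup>2 < e\<^sup>2"
    by (simp add: ennreal_less_iff)
  then have "dist (to_l2 ?w) (to_l2 ?a) < e"
    using \<open>e > 0\<close> by (simp add: dist_norm power_less_imp_less_base)
  moreover have "W n \<in> ?F"
    using W B' fW by auto
  ultimately show "\<exists>y\<in>?h ` ?F. dist y (to_l2 ?a) < e"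
    by blast
qed

lemma subspace_closure_span:
  fixes E :: "'a::real_normed_vector set"
  shows "subspace (closure (span E))"
proof (rule subspaceI)
  show "0 \<in> closure (span E)"
    using span_zero closure_subset by blast
next
  fix x y assume "x \<in> closure (span E)" "y \<in> closure (span E)"
  then obtain f g where "\<And>n. f n \<in> span E" "f \<longlonglongrightarrow> x" "\<And>n. g n \<in> span E" "g \<longlonglongrightarrow> y"
    by (auto simp: closure_sequential)
  then show "x + y \<in> closure (span E)"
    unfolding closure_sequential
    by (intro exI[of _ "\<lambda>n. f n + g n"]) (auto intro: span_add tendsto_add)
next
  fix c x assume "x \<in> closure (span E)"
  then obtain f where "\<And>n. f n \<in> span E" "f \<longlonglongrightarrow> x"
    by (auto simp: closure_sequential)
  then show "c *\<^sub>R x \<in> closure (span E)"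
    unfolding closure_sequential
    by (intro exI[of _ "\<lambda>n. c *\<^sub>R f n"]) (auto intro: span_scale tendsto_scaleR)
qed

lemma l2_in_closed_subspace:
  fixes C :: "'a::euclidean_space l2 set"
  assumes "closed C" "subspace C"
  assumes ind: "\<And>A. A \<in> sets borel \<Longrightarrow> emeasure lborel A < \<infinity> \<Longrightarrow> to_l2 (indicat_real A) \<in> C"
  assumes f: "square_integrable f"
  shows "to_l2 f \<in> C"
proof -
  have [measurable]: "f \<in> borel_measurable borel"
    using f by (simp add: square_integrable_def)
  obtain s where s: "\<And>i. simple_function lborel (s i)" "\<And>x. (\<lambda>i. s i x) \<longlonglongrightarrow> f x"
    "\<And>i x. \<bar>s i x\<bar> \<le> 2 * \<bar>f x\<bar>"
    using borel_measurable_implies_sequence_metric[of f lborel 0] by auto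
  have [measurable]: "s i \<in> borel_measurable borel" for i
    using borel_measurable_simple_function[OF s(1)[of i]] by simp
  have sb: "(s i x)\<^sup>2 \<le> 4 * (f x)\<^sup>2" for i x
    using power_mono[OF s(3)[of i x], of 2] by (simp add: power_mult_distrib)
  have int4: "integrable lborel (\<lambda>x. 4 * (f x)\<^sup>2)"
    using f by (simp add: square_integrable_def)
  have sqs: "square_integrable (s i)" for i
    unfolding square_integrable_def
    by (intro conjI Bochner_Integration.integrable_bound[OF int4]) (auto simp: sb)
  have inC: "to_l2 (s i) \<in> C" for i
  proof -
    let ?S = "\<lambda>y. s i -` {y}"
    have Sm: "?S y \<in> sets borel" for y
      using measurable_sets[of "s i" borel borel "{y}"] by simp
    have piece: "square_integrable (\<lambda>x. y * indicat_real (?S y) x) \<and>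
        to_l2 (\<lambda>x. y * indicat_real (?S y) x) \<in> C" for y
    proof (cases "y = 0")
      case True
      then show ?thesis
        using \<open>subspace C\<close> by (simp add: to_l2_zero subspace_0)
    next
      case False
      have "ennreal (y\<^sup>2) * emeasure lborel (?S y) = (\<integral>\<^sup>+x. ennreal (y\<^sup>2) * indicator (?S y) x \<partial>lborel)"
        using Sm by (subst nn_integral_cmult_indicator) auto
      also have "\<dots> \<le> (\<integral>\<^sup>+x. ennreal ((s i x)\<^sup>2) \<partial>lborel)"
        by (intro nn_integral_mono) (auto simp: indicator_def)
      also have "\<dots> < \<infinity>"
        using sqs[of i] by (simp add: norm_to_l2_ennreal)
      finally have "emeasure lborel (?S y) < \<infinity>"
        using False by (auto simp: ennreal_mult_less_top)
      then show ?thesis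
        using Sm ind \<open>subspace C\<close>
        by (simp add: to_l2_scale square_integrable_indicator square_integrable_scale subspace_scale)
    qed
    have eq: "s i x = (\<Sum>y\<in>range (s i). y * indicat_real (?S y) x)" for x
    proof -
      have "s i x = (\<Sum>y\<in>s i ` space lborel. indicator (s i -` {y} \<inter> space lborel) x *\<^sub>R y)"
        by (rule simple_function_indicator_representation_banach[OF s(1)]) simp
      also have "\<dots> = (\<Sum>y\<in>range (s i). y * indicat_real (?S y) x)"
        by (rule sum.cong) auto
      finally show ?thesis .
    qed
    have fin: "finite (range (s i))"
      using s(1)[of i] by (simp add: simple_function_def)
    have "to_l2 (s i) = to_l2 (\<lambda>x. \<Sum>y\<in>range (s i). y * indicat_real (?S y) x)"
      by (rule arg_cong[where f = to_l2], rule ext, rule eq)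
    also have "\<dots> = (\<Sum>y\<in>range (s i). to_l2 (\<lambda>x. y * indicat_real (?S y) x))"
      using to_l2_sum[OF fin, of "\<lambda>y x. y * indicat_real (?S y) x"] piece by blast
    finally have "to_l2 (s i) = (\<Sum>y\<in>range (s i). to_l2 (\<lambda>x. y * indicat_real (?S y) x))" .
    then show ?thesis
      using piece \<open>subspace C\<close> by (simp add: subspace_sum)
  qed
  have "(\<lambda>i. LINT x|lborel. (s i x - f x)\<^sup>2) \<longlonglongrightarrow> integral\<^sup>L lborel (\<lambda>_ :: 'a. 0 :: real)"
  proof (rule integral_dominated_convergence[where w = "\<lambda>x. 9 * (f x)\<^sup>2"])
    show "integrable lborel (\<lambda>x. 9 * (f x)\<^sup>2)"
      using f by (simp add: square_integrable_def)
    show "AE x in lborel. (\<lambda>i. (s i x - f x)\<^sup>2) \<longlonglongrightarrow> 0"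
    proof (rule AE_I2)
      fix x
      have "(\<lambda>i. (s i x - f x)\<^sup>2) \<longlonglongrightarrow> (f x - f x)\<^sup>2"
        by (intro tendsto_intros s)
      then show "(\<lambda>i. (s i x - f x)\<^sup>2) \<longlonglongrightarrow> 0" by simp
    qed
    show "AE x in lborel. norm ((s i x - f x)\<^sup>2) \<le> 9 * (f x)\<^sup>2" for i
    proof (rule AE_I2)
      fix x
      have "\<bar>s i x - f x\<bar> \<le> 3 * \<bar>f x\<bar>"
        using s(3)[of i x] by linarith
      from power_mono[OF this, of 2] show "norm ((s i x - f x)\<^sup>2) \<le> 9 * (f x)\<^sup>2"
        by (simp add: power_mult_distrib)
    qed
  qed auto
  then have "(\<lambda>i. sqrt (LINT x|lborel. (s i x - f x)\<^sup>2)) \<longlonglongrightarrow> sqrt (integral\<^sup>L lborel (\<lambda>_ :: 'a. 0))"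
    by (rule tendsto_real_sqrt)
  moreover have "norm (to_l2 (s i) - to_l2 f) = sqrt (LINT x|lborel. (s i x - f x)\<^sup>2)" for i
    by (subst to_l2_diff[symmetric]) (simp_all add: norm_to_l2 square_integrable_diff sqs f)
  ultimately have "(\<lambda>i. norm (to_l2 (s i) - to_l2 f)) \<longlonglongrightarrow> 0"
    by simp
  then have "(\<lambda>i. to_l2 (s i) - to_l2 f) \<longlonglongrightarrow> 0"
    by (rule tendsto_norm_zero_cancel)
  then have "(\<lambda>i. to_l2 (s i)) \<longlonglongrightarrow> to_l2 f"
    by (rule LIM_zero_cancel)
  then show ?thesis
    using closed_sequentially[OF \<open>closed C\<close>, of "\<lambda>i. to_l2 (s i)"] inC by simp
qed

instance l2 :: (euclidean_space) second_countable_topology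
proof
  obtain B :: "'a set set" where B: "countable B" "topological_basis B"
    using ex_countable_basis by blast
  define E where "E = (\<lambda>F. to_l2 (indicat_real (\<Union>F))) `
    {F. finite F \<and> F \<subseteq> B \<and> emeasure lborel (\<Union>F) < \<infinity>}"
  have "countable E"
    unfolding E_def
    by (intro countable_image countable_subset[OF _ countable_Collect_finite_subset[OF B(1)]]) auto
  moreover have "closure (span E) = UNIV"
  proof -
    have "to_l2 f \<in> closure (span E)" if "square_integrable f" for f
    proof (rule l2_in_closed_subspace[OF _ _ _ that])
      fix A :: "'a set" assume "A \<in> sets borel" "emeasure lborel A < \<infinity>"
      then have "to_l2 (indicat_real A) \<in> closure E"
        unfolding E_def by (rule indicator_in_closure[OF B])
      then show "to_l2 (indicat_real A) \<in> closure (span E)"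
        using closure_mono[of E "span E"] span_superset by blast
    qed (simp_all add: subspace_closure_span)
    then show ?thesis
      using l2_cases by (metis UNIV_eq_I)
  qed
  ultimately obtain D :: "'a l2 set" where "countable D" "closure D = UNIV"
    using countable_dense_of_span by blast
  then show "\<exists>B :: 'a l2 set set. countable B \<and> open = generate_topology B"
    by (rule dense_imp_countable_subbasis)
qed

section \<open>Function spaces on an interval\<close>

text \<open>
  \<open>L\<^sup>2(\<Omega>)\<close> is realised inside \<open>L\<^sup>2(\<real>\<^sup>n)\<close> by extension by zero, which preserves the inner product.
\<close>

definition L2_on :: "'a::euclidean_space set \<Rightarrow> 'a l2 set" where
  "L2_on \<Omega> = {u. AE x in lborel. x \<notin> \<Omega> \<longrightarrow> rep_l2 u x = 0}"

definition test_function :: "real \<Rightarrow> (real \<Rightarrow> real) \<Rightarrow> (real \<Rightarrow> real) \<Rightarrow> bool" where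
  "test_function l \<phi> \<phi>' \<longleftrightarrow>
    (\<forall>x. (\<phi> has_real_derivative \<phi>' x) (at x)) \<and> continuous_on UNIV \<phi>' \<and>
    (\<exists>K. compact K \<and> K \<subseteq> {0<..<l} \<and> (\<forall>x. x \<notin> K \<longrightarrow> \<phi> x = 0))"

definition weak_derivative :: "real \<Rightarrow> real l2 \<Rightarrow> real l2 \<Rightarrow> bool" where
  "weak_derivative l u v \<longleftrightarrow>
    (\<forall>\<phi> \<phi>'. test_function l \<phi> \<phi>' \<longrightarrow>
      (LBINT x:{0<..<l}. rep_l2 u x * \<phi>' x) = - (LBINT x:{0<..<l}. rep_l2 v x * \<phi> x))"

text \<open>
  A Sobolev function is stored together with its (unique) weak derivatives. For \<open>H\<^sup>1(0,l)\<close> the norm of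
  the pair \<open>(u, u\<^sub>x)\<close> in the product type is then exactly the \<open>H\<^sup>1\<close>-norm of \<open>u\<close>.
\<close>

definition H1 :: "real \<Rightarrow> (real l2 \<times> real l2) set" where
  "H1 l = {(u, ux). u \<in> L2_on {0<..<l} \<and> ux \<in> L2_on {0<..<l} \<and> weak_derivative l u ux}"

definition H2 :: "real \<Rightarrow> (real l2 \<times> real l2 \<times> real l2) set" where
  "H2 l = {(u, ux, uxx). (u, ux) \<in> H1 l \<and> (ux, uxx) \<in> H1 l}"

text \<open>\<open>u(0) = a\<close> and \<open>u(l) = b\<close> for the continuous representative of \<open>u\<close> on \<open>[0,l]\<close>.\<close>

definition boundary_values :: "real \<Rightarrow> real l2 \<Rightarrow> real \<Rightarrow> real \<Rightarrow> bool" where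
  "boundary_values l u a b \<longleftrightarrow>
    (\<exists>g. continuous_on {0..l} g \<and> (AE x in lborel. x \<in> {0<..<l} \<longrightarrow> rep_l2 u x = g x) \<and>
      g 0 = a \<and> g l = b)"

type_synonym l2_state = "real l2 \<times> real \<times> real"
type_synonym h1_state = "(real l2 \<times> real l2) \<times> real \<times> real"
type_synonym energy_state = "h1_state \<times> l2_state"

definition LL2 :: "real \<Rightarrow> l2_state set" where
  "LL2 l = {(y, a, b). y \<in> L2_on {0<..<l}}"

definition HH1 :: "real \<Rightarrow> h1_state set" where
  "HH1 l = {((u, ux), a, b). (u, ux) \<in> H1 l \<and> boundary_values l u a b}"

definition H_en :: "real \<Rightarrow> energy_state set" where
  "H_en l = HH1 l \<times> LL2 l"

text \<open>The inclusion of \<open>HH1\<close> into \<open>LL2\<close>.\<close>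

definition h1_to_l2 :: "h1_state \<Rightarrow> l2_state" where
  "h1_to_l2 = (\<lambda>((u, ux), a, b). (u, a, b))"


section \<open>The wave operator and the group it generates\<close>

text \<open>
  Unbounded operators are given by their graphs. The first components of \<open>wave_B l\<close> are the triples
  \<open>(u, u(0), u(l))\<close> with \<open>u \<in> H\<^sup>2(0,l)\<close>; there \<open>p = u\<^sub>x(0)\<close> and \<open>q = u\<^sub>x(l)\<close>.
\<close>

definition wave_B :: "real \<Rightarrow> (h1_state \<times> l2_state) set" where
  "wave_B l = {(((u, ux), a, b), (uxx, p, - q)) | u ux uxx a b p q.
    (u, ux, uxx) \<in> H2 l \<and> boundary_values l u a b \<and> boundary_values l ux p q}"

definition wave_A :: "real \<Rightarrow> (energy_state \<times> energy_state) set" where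
  "wave_A l = {((Y, h1_to_l2 Z), (Z, W)) | Y Z W. (Y, W) \<in> wave_B l \<and> Z \<in> HH1 l}"

definition strongly_continuous_group ::
    "'a::real_normed_vector set \<Rightarrow> (real \<Rightarrow> 'a \<Rightarrow> 'a) \<Rightarrow> bool" where
  "strongly_continuous_group X S \<longleftrightarrow>
    (\<forall>t. \<forall>x\<in>X. S t x \<in> X) \<and>
    (\<forall>t. \<forall>x\<in>X. \<forall>y\<in>X. \<forall>c d. S t (c *\<^sub>R x + d *\<^sub>R y) = c *\<^sub>R S t x + d *\<^sub>R S t y) \<and>
    (\<forall>t. \<exists>K. \<forall>x\<in>X. norm (S t x) \<le> K * norm x) \<and>
    (\<forall>x\<in>X. S 0 x = x) \<and>
    (\<forall>s t. \<forall>x\<in>X. S (s + t) x = S s (S t x)) \<and>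
    (\<forall>x\<in>X. continuous_on UNIV (\<lambda>t. S t x))"

definition group_generator ::
    "'a::real_normed_vector set \<Rightarrow> (real \<Rightarrow> 'a \<Rightarrow> 'a) \<Rightarrow> ('a \<times> 'a) set" where
  "group_generator X S =
    {(x, y). x \<in> X \<and> y \<in> X \<and> ((\<lambda>h. (S h x - x) /\<^sub>R h) \<longlongrightarrow> y) (at 0)}"

definition generates_group ::
    "'a::real_normed_vector set \<Rightarrow> ('a \<times> 'a) set \<Rightarrow> (real \<Rightarrow> 'a \<Rightarrow> 'a) \<Rightarrow> bool" where
  "generates_group X A S \<longleftrightarrow> strongly_continuous_group X S \<and> group_generator X S = A"


section \<open>Mild solutions and the minimization problem\<close>

type_synonym wave_source = "(real \<times> real) l2 \<times> real l2"

definition LL2_T :: "real \<Rightarrow> real \<Rightarrow> wave_source set" where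
  "LL2_T T l = L2_on ({0<..<T} \<times> {0<..<l}) \<times> L2_on {0<..<T}"

text \<open>
  The class of \<open>F(s, \<cdot>)\<close> in \<open>L\<^sup>2(0,l)\<close>; changing the representative of \<open>F\<close> alters it only for \<open>s\<close> in a
  null set. The cut-off puts it into \<open>L\<^sup>2(0,l)\<close> for every \<open>s\<close>, not just almost every \<open>s\<close>.
\<close>

definition slice :: "real \<Rightarrow> (real \<times> real) l2 \<Rightarrow> real \<Rightarrow> real l2" where
  "slice l F s = to_l2 (\<lambda>x. indicator {0<..<l} x * rep_l2 F (s, x))"

definition forcing :: "real \<Rightarrow> wave_source \<Rightarrow> real \<Rightarrow> energy_state" where
  "forcing l W s = (((0, 0), 0, 0), (slice l (fst W) s, rep_l2 (snd W) s, 0))"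

text \<open>Duhamel's formula for \<open>(Y(t), Y\<^sub>t(t))\<close>, where \<open>S t\<close> plays the role of \<open>e\<^sup>t\<^sup>A\<close>.\<close>

definition mild_solution ::
    "real \<Rightarrow> (real \<Rightarrow> energy_state \<Rightarrow> energy_state) \<Rightarrow> energy_state \<Rightarrow> wave_source \<Rightarrow> real \<Rightarrow> energy_state"
  where
  "mild_solution l S Z0 W t = S t Z0 + (LBINT s:{0..t}. S (t - s) (forcing l W s))"

definition displacement ::
    "real \<Rightarrow> (real \<Rightarrow> energy_state \<Rightarrow> energy_state) \<Rightarrow> energy_state \<Rightarrow> wave_source \<Rightarrow> real \<Rightarrow> l2_state"
  where
  "displacement l S Z0 W t = h1_to_l2 (fst (mild_solution l S Z0 W t))"

definition admissible :: "real \<Rightarrow> real \<Rightarrow> real \<Rightarrow> real \<Rightarrow> real \<Rightarrow> real \<Rightarrow> wave_source set" where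
  "admissible T l Fmin Fmax Gmin Gmax = {(F, G) \<in> LL2_T T l.
    (AE z in lborel. z \<in> {0<..<T} \<times> {0<..<l} \<longrightarrow> Fmin \<le> rep_l2 F z \<and> rep_l2 F z \<le> Fmax) \<and>
    (AE t in lborel. t \<in> {0<..<T} \<longrightarrow> Gmin \<le> rep_l2 G t \<and> rep_l2 G t \<le> Gmax)}"

definition cost ::
    "real \<Rightarrow> real \<Rightarrow> (real \<Rightarrow> energy_state \<Rightarrow> energy_state) \<Rightarrow> energy_state \<Rightarrow> l2_state \<Rightarrow> wave_source \<Rightarrow> real"
  where
  "cost T l S Z0 Yd W = 1 / 2 * (norm (displacement l S Z0 W T - Yd))\<^sup>2"

definition solves_minimization :: "('a \<Rightarrow> real) \<Rightarrow> 'a set \<Rightarrow> 'a \<Rightarrow> bool" where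
  "solves_minimization J U W \<longleftrightarrow> W \<in> U \<and> J W = (INF W'\<in>U. J W')"

end

theory Submission
  imports Defs
begin

text \<open>
  Duhamel's integral is a bounded linear function of the source, so \<open>W \<mapsto> Y(T,\<cdot>,W)\<close> is affine and
  continuous and the cost is continuous and convex. The admissible set is closed, convex and bounded
  in a Hilbert space; there a decreasing sequence of such sets has a common point, found as the limit
  of points of almost minimal norm, and this gives a minimizer without weak compactness. Two distinct
  minimizers in \<open>V\<close> would have different terminal states, and by the parallelogram identity their
  midpoint would have a strictly smaller cost.
\<close>

subsection \<open>Minimization over closed bounded convex sets\<close>

text \<open>The squared distances \<open>d n\<close> of the sets from the origin increase and stay
  bounded, hence converge. By the parallelogram identity, points that almost attain
  \<open>d n\<close> then form a Cauchy sequence. Its limit lies in every \<open>C n\<close>,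
  because each tail of the sequence does.\<close>

lemma decseq_convex_Inter_nonempty:
  fixes C :: "nat \<Rightarrow> 'a::{real_inner, complete_space} set"
  assumes closed: "\<And>n. closed (C n)" and convex: "\<And>n. convex (C n)"
    and nonempty: "\<And>n. C n \<noteq> {}" and "decseq C" and "bounded (C 0)"
  shows "(\<Inter>n. C n) \<noteq> {}"
proof -
  define d where "d n = (INF x\<in>C n. (norm x)\<^sup>2)" for n
  have bdd: "bdd_below ((\<lambda>x. (norm x)\<^sup>2) ` C n)" for n
    by (intro bdd_belowI[of _ 0]) auto
  have d_le: "d n \<le> (norm x)\<^sup>2" if "x \<in> C n" for n x
    unfolding d_def using bdd that by (rule cINF_lower)
  have sub: "C m \<subseteq> C n" if "n \<le> m" for n m
    using \<open>decseq C\<close> that by (auto simp: decseq_def)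
  have "incseq d"
    unfolding incseq_def d_def
    by (intro allI impI cINF_superset_mono) (use nonempty bdd sub in auto)
  moreover obtain B where B: "\<And>x. x \<in> C 0 \<Longrightarrow> norm x \<le> B"
    using \<open>bounded (C 0)\<close> by (auto simp: bounded_iff)
  have "d n \<le> B\<^sup>2" for n
  proof -
    obtain x where "x \<in> C n" using nonempty[of n] by blast
    with d_le[of x n] sub[of 0 n] B[of x] power_mono[of "norm x" B 2] show ?thesis by auto
  qed
  ultimately obtain L where "d \<longlonglongrightarrow> L"
    by (metis incseq_convergent)
  then have "Cauchy d"
    by (rule LIMSEQ_imp_Cauchy)
  define \<epsilon> where "\<epsilon> n = 1 / real (Suc n)" for n
  have \<epsilon>_mono: "\<epsilon> m \<le> \<epsilon> n" if "n \<le> m" for n m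
    using that by (simp add: \<epsilon>_def frac_le)
  have "\<exists>x\<in>C n. (norm x)\<^sup>2 < d n + \<epsilon> n" for n
    using cINF_less_iff[OF nonempty[of n] bdd[of n], of "d n + \<epsilon> n"]
    by (simp add: d_def \<epsilon>_def)
  then obtain x where x: "\<And>n. x n \<in> C n" "\<And>n. (norm (x n))\<^sup>2 < d n + \<epsilon> n"
    by metis
  have close: "(norm (x n - x m))\<^sup>2 \<le> 2 * (d m - d n) + 4 * \<epsilon> n" if "n \<le> m" for n m
  proof -
    \<comment> \<open>The midpoint belongs to the larger set \<open>C n\<close>, so its squared norm
      is at least \<open>d n\<close>. This lower bound on the sum forces the difference to be
      small.\<close>
    have "(1/2) *\<^sub>R x n + (1/2) *\<^sub>R x m \<in> C n"
      using x(1)[of n] x(1)[of m] sub[OF that] by (intro convexD[OF convex]) auto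
    then have "d n \<le> (norm ((1/2) *\<^sub>R (x n + x m)))\<^sup>2"
      using d_le by (simp add: scaleR_add_right)
    then have "4 * d n \<le> (norm (x n + x m))\<^sup>2"
      by (simp add: power_divide)
    moreover have "(norm (x n - x m))\<^sup>2 + (norm (x n + x m))\<^sup>2 = 2 * (norm (x n))\<^sup>2 + 2 * (norm (x m))\<^sup>2"
      by (simp add: power2_norm_eq_inner inner_diff_left inner_diff_right inner_add_left inner_add_right)
    ultimately show ?thesis
      using x(2)[of n] x(2)[of m] \<epsilon>_mono[OF that] by argo
  qed
  have "Cauchy x"
  proof (rule metric_CauchyI)
    fix e :: real assume "e > 0"
    \<comment> \<open>With this threshold the two terms in \<open>close\<close> contribute less than
      \<open>e\<^sup>2 / 4\<close> and \<open>e\<^sup>2 / 2\<close>.\<close>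
    then have "e\<^sup>2 / 8 > 0" by simp
    then obtain N1 where N1: "\<And>m n. m \<ge> N1 \<Longrightarrow> n \<ge> N1 \<Longrightarrow> dist (d m) (d n) < e\<^sup>2 / 8"
      using \<open>Cauchy d\<close> unfolding Cauchy_def by meson
    obtain N2 where N2: "\<epsilon> N2 < e\<^sup>2 / 8"
      unfolding \<epsilon>_def using nat_approx_posE \<open>e\<^sup>2 / 8 > 0\<close> by blast
    have *: "dist (x n) (x m) < e" if "max N1 N2 \<le> n" "n \<le> m" for n m
    proof -
      have "\<epsilon> n \<le> \<epsilon> N2"
        using that by (intro \<epsilon>_mono) simp
      moreover have "d m - d n < e\<^sup>2 / 8"
        using N1[of m n] that unfolding dist_real_def by linarith
      ultimately have "(norm (x n - x m))\<^sup>2 < e\<^sup>2"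
        using close[OF that(2)] N2 \<open>e\<^sup>2 / 8 > 0\<close> by argo
      then show ?thesis
        using \<open>e > 0\<close> by (simp add: dist_norm power_less_imp_less_base)
    qed
    show "\<exists>M. \<forall>m\<ge>M. \<forall>n\<ge>M. dist (x m) (x n) < e"
      by (rule exI[of _ "max N1 N2"]) (metis * dist_commute linear)
  qed
  then obtain z where z: "x \<longlonglongrightarrow> z"
    using Cauchy_convergent_iff convergent_def by blast
  have "z \<in> C n" for n
  proof (rule closed_sequentially[OF closed])
    show "x (k + n) \<in> C n" for k
      using x(1)[of "k + n"] sub[of n "k + n"] by auto
    show "(\<lambda>k. x (k + n)) \<longlonglongrightarrow> z"
      using z by (rule LIMSEQ_ignore_initial_segment)
  qed
  then show ?thesis by blast
qed

text \<open>The sublevel sets at the heights \<open>I + 1 / real (Suc n)\<close> shrink to the set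
  of minimizers, and the previous lemma supplies a common point. Convexity is asked of sublevel
  sets, since those of the cost are preimages of balls under a linear map.\<close>

lemma quasiconvex_attains_INF:
  fixes J :: "'a::{real_inner, complete_space} \<Rightarrow> real"
  assumes C: "closed C" "bounded C" "C \<noteq> {}" and "continuous_on C J"
    and convex: "\<And>r. convex {x \<in> C. J x \<le> r}" and bdd: "bdd_below (J ` C)"
  shows "\<exists>x\<in>C. J x = (INF y\<in>C. J y)"
proof -
  define I where "I = (INF y\<in>C. J y)"
  let ?C = "\<lambda>n. {x \<in> C. J x \<le> I + 1 / real (Suc n)}"
  have "(\<Inter>n. ?C n) \<noteq> {}"
  proof (rule decseq_convex_Inter_nonempty)
    fix n
    have "{x \<in> C. J x \<le> I + 1 / real (Suc n)} = C \<inter> J -` {..I + 1 / real (Suc n)}"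
      by auto
    then show "closed (?C n)"
      using continuous_on_closed_vimage[OF C(1)] assms(4) by (metis closed_atMost inf_commute)
    have "\<exists>x\<in>C. J x < I + 1 / real (Suc n)"
      using cINF_less_iff[OF C(3) bdd, of "I + 1 / real (Suc n)"] by (simp add: I_def)
    then show "?C n \<noteq> {}"
      by (auto intro: less_imp_le)
    show "bounded (?C 0)"
      using C(2) by (rule bounded_subset) auto
  next
    show "decseq ?C"
    proof (rule antimonoI, safe)
      fix m n :: nat and x assume "m \<le> n" "J x \<le> I + 1 / real (Suc n)"
      moreover from \<open>m \<le> n\<close> have "1 / real (Suc n) \<le> 1 / real (Suc m)"
        by (simp add: frac_le)
      ultimately show "J x \<le> I + 1 / real (Suc m)" by linarith
    qed
  qed (rule convex)
  then obtain x where x: "\<And>n. x \<in> C \<and> J x \<le> I + 1 / real (Suc n)"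
    by auto
  have "J x \<le> I"
  proof (rule field_le_epsilon)
    fix e :: real assume "e > 0"
    then obtain n where "1 / real (Suc n) < e" by (rule nat_approx_posE)
    with x[of n] show "J x \<le> I + e" by linarith
  qed
  moreover have "I \<le> J x"
    unfolding I_def using bdd x by (intro cINF_lower) auto
  ultimately show ?thesis
    using x unfolding I_def by (metis antisym)
qed

subsection \<open>Strongly continuous groups\<close>

text \<open>A uniform bound for times near some \<open>s\<close> is moved to times near
  \<open>0\<close> by composing with \<open>S (- s)\<close>. The group law then extends it to
  \<open>\<bar>t\<bar> \<le> R\<close> by splitting \<open>t\<close> into \<open>k\<close> equal
  short steps.\<close>

lemma strongly_continuous_group_locally_bounded:
  assumes "strongly_continuous_group X S"
  shows "\<exists>K\<ge>0. \<forall>t x. \<bar>t\<bar> \<le> R \<longrightarrow> x \<in> X \<longrightarrow> norm (S t x) \<le> K * norm x"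
proof -
  have S_in: "S t x \<in> X" if "x \<in> X" for t x
    using assms that by (simp add: strongly_continuous_group_def)
  have S_add: "S (s + t) x = S s (S t x)" if "x \<in> X" for s t x
    using assms that by (simp add: strongly_continuous_group_def)
  have S_0: "S 0 x = x" if "x \<in> X" for x
    using assms that by (simp add: strongly_continuous_group_def)
  have S_bdd: "\<exists>K. \<forall>x\<in>X. norm (S t x) \<le> K * norm x" for t
    using assms by (simp add: strongly_continuous_group_def)
  have S_cont: "continuous_on UNIV (\<lambda>t. S t x)" if "x \<in> X" for x
    using assms that by (simp add: strongly_continuous_group_def)
  \<comment> \<open>Baire on the time axis replaces the uniform boundedness principle, so \<open>X\<close> need not be complete.\<close>
  define A where "A n = (\<Inter>x\<in>X. {t. norm (S t x) \<le> real n * norm x})" for n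
  have closed_A: "closed (A n)" for n
    unfolding A_def
    by (intro closed_INT ballI closed_Collect_le continuous_on_norm continuous_on_const S_cont)
  have cover: "\<exists>n. t \<in> A n" for t
  proof -
    obtain K where K: "\<And>x. x \<in> X \<Longrightarrow> norm (S t x) \<le> K * norm x"
      using S_bdd by blast
    obtain n where "K \<le> real n"
      using real_arch_simple by blast
    then have "norm (S t x) \<le> real n * norm x" if "x \<in> X" for x
      using K[OF that] mult_right_mono[of K "real n" "norm x"] by simp
    then show ?thesis
      by (auto simp: A_def)
  qed
  have "\<exists>n. interior (A n) \<noteq> {}"
  proof (rule ccontr)
    assume "\<not> ?thesis"
    then have "UNIV \<subseteq> closure (\<Inter>(range (\<lambda>n. - A n)))"
      using closed_A by (intro Baire) (auto simp: closure_complement)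
    moreover have "(\<Inter>(range (\<lambda>n. - A n))) = {}"
      using cover by auto
    ultimately show False by (metis UNIV_not_empty closure_empty subset_empty)
  qed
  then obtain n s where "s \<in> interior (A n)" by blast
  then obtain r where r: "r > 0" "ball s r \<subseteq> A n"
    by (auto simp: mem_interior)
  obtain K where K: "\<And>x. x \<in> X \<Longrightarrow> norm (S (- s) x) \<le> K * norm x"
    using S_bdd by blast
  \<comment> \<open>Nothing is known about the sign of \<open>K\<close>; the maximum with
    \<open>0\<close> keeps \<open>M\<close> and its powers nonnegative.\<close>
  define M where "M = max 0 (real n * K)"
  have small: "norm (S h x) \<le> M * norm x" if "\<bar>h\<bar> < r" "x \<in> X" for h x
  proof -
    have "s + h \<in> A n"
      using r(2) that by (auto simp: dist_real_def)
    then have "norm (S (s + h) (S (- s) x)) \<le> real n * norm (S (- s) x)"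
      using S_in[OF that(2)] by (auto simp: A_def)
    also have "\<dots> \<le> real n * (K * norm x)"
      using K that by (intro mult_left_mono) auto
    also have "\<dots> \<le> M * norm x"
      by (auto simp: M_def mult.assoc[symmetric] intro!: mult_right_mono)
    finally show ?thesis
      using S_add[OF that(2), of "s + h" "- s"] by simp
  qed
  have iter: "norm (S (real k * h) x) \<le> M ^ k * norm x" if "\<bar>h\<bar> < r" "x \<in> X" for k h x
  proof (induction k)
    case (Suc k)
    have "S (real (Suc k) * h) x = S h (S (real k * h) x)"
      using S_add[OF that(2), of h "real k * h"] by (simp add: distrib_right)
    then have "norm (S (real (Suc k) * h) x) \<le> M * norm (S (real k * h) x)"
      using small[OF that(1) S_in[OF that(2)]] by simp
    also have "\<dots> \<le> M * (M ^ k * norm x)"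
      using Suc by (intro mult_left_mono) (auto simp: M_def)
    finally show ?case by (simp add: mult.assoc)
  qed (simp add: S_0 that)
  obtain k where k: "\<bar>R\<bar> / r < real k"
    using reals_Archimedean2 by blast
  then have "k > 0"
    using r(1) by (cases k) (auto simp: divide_less_0_iff not_less)
  show ?thesis
  proof (intro exI[of _ "M ^ k"] conjI allI impI)
    show "0 \<le> M ^ k"
      by (simp add: M_def)
    fix t x assume t: "\<bar>t\<bar> \<le> R" "x \<in> X"
    have "\<bar>t\<bar> < r * real k"
      using k t r(1) by (simp add: divide_less_eq mult.commute)
    then have "\<bar>t / real k\<bar> < r"
      using \<open>k > 0\<close> by (simp add: divide_less_eq)
    from iter[OF this t(2), of k] show "norm (S t x) \<le> M ^ k * norm x"
      using \<open>k > 0\<close> by simp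
  qed
qed

lemma strongly_continuous_group_diff:
  assumes "strongly_continuous_group X S" "x \<in> X" "y \<in> X"
  shows "S t (x - y) = S t x - S t y"
proof -
  have "S t (1 *\<^sub>R x + (-1) *\<^sub>R y) = 1 *\<^sub>R S t x + (-1) *\<^sub>R S t y"
    using assms unfolding strongly_continuous_group_def by blast
  then show ?thesis by simp
qed

text \<open>The difference of values splits into \<open>S (t n) (x n - x0)\<close>, controlled by
  the locally uniform bound, and the change of \<open>S t x0\<close> in time alone. The bound
  applies only on \<open>X\<close>, and \<open>strongly_continuous_group\<close> does not make
  \<open>X\<close> a subspace; hence the set \<open>Y\<close> whose differences lie in
  \<open>X\<close>.\<close>

lemma strongly_continuous_group_jointly_continuous:
  assumes S: "strongly_continuous_group X S"
    and X: "Y \<subseteq> X" "\<And>x y. x \<in> Y \<Longrightarrow> y \<in> Y \<Longrightarrow> x - y \<in> X"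
  shows "continuous_on (UNIV \<times> Y) (\<lambda>(t, x). S t x)"
  unfolding continuous_on_sequentially
proof (intro ballI allI impI, elim conjE)
  fix p :: "nat \<Rightarrow> real \<times> 'a" and p0 assume p0: "p0 \<in> UNIV \<times> Y"
    and p: "\<forall>n. p n \<in> UNIV \<times> Y" and lim: "p \<longlonglongrightarrow> p0"
  define t x t0 x0 where "t = (\<lambda>n. fst (p n))" and "x = (\<lambda>n. snd (p n))"
    and "t0 = fst p0" and "x0 = snd p0"
  have Y: "x n \<in> Y" "x0 \<in> Y" for n
    using p p0 by (auto simp: x_def x0_def mem_Times_iff)
  have t: "t \<longlonglongrightarrow> t0" and x: "x \<longlonglongrightarrow> x0"
    using tendsto_fst[OF lim] tendsto_snd[OF lim] by (simp_all add: t_def x_def t0_def x0_def)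
  have "Bseq t"
    using t by (intro convergent_imp_Bseq) (auto simp: convergent_def)
  then obtain R where R: "\<And>n. \<bar>t n\<bar> \<le> R"
    by (auto simp: Bseq_def)
  obtain K where "0 \<le> K"
    and K: "\<And>t x. \<bar>t\<bar> \<le> R \<Longrightarrow> x \<in> X \<Longrightarrow> norm (S t x) \<le> K * norm x"
    using strongly_continuous_group_locally_bounded[OF S, of R] by auto
  have "(\<lambda>n. S (t n) (x n) - S (t n) x0) \<longlonglongrightarrow> 0"
  proof (rule Lim_null_comparison)
    show "\<forall>\<^sub>F n in sequentially. norm (S (t n) (x n) - S (t n) x0) \<le> K * norm (x n - x0)"
    proof (intro always_eventually allI)
      fix n
      have "x n \<in> X" "x0 \<in> X" using Y X(1) by auto
      then show "norm (S (t n) (x n) - S (t n) x0) \<le> K * norm (x n - x0)"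
        using K[OF R[of n] X(2)[OF Y(1)[of n] Y(2)]]
          strongly_continuous_group_diff[OF S, of "x n" x0 "t n"] by (simp only:)
    qed
    show "(\<lambda>n. K * norm (x n - x0)) \<longlonglongrightarrow> 0"
      by (rule tendsto_mult_right_zero[OF tendsto_norm_zero[OF LIM_zero[OF x]]])
  qed
  moreover have "(\<lambda>n. S (t n) x0) \<longlonglongrightarrow> S t0 x0"
  proof -
    have "continuous_on UNIV (\<lambda>t. S t x0)"
      using S X(1) Y(2) by (auto simp: strongly_continuous_group_def)
    then show ?thesis
      using t by (intro continuous_on_tendsto_compose[of UNIV "\<lambda>t. S t x0"]) auto
  qed
  ultimately have "(\<lambda>n. (S (t n) (x n) - S (t n) x0) + S (t n) x0) \<longlonglongrightarrow> 0 + S t0 x0"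
    by (rule tendsto_add)
  then show "((\<lambda>(t, x). S t x) \<circ> p) \<longlonglongrightarrow> (\<lambda>(t, x). S t x) p0"
    by (simp add: t_def x_def t0_def x0_def o_def split_beta)
qed

text \<open>By the Lindelof property an open set is a countable union of balls, and preimages of
  balls are described by distances. For time slices these distances are explicit parameter
  integrals.\<close>

lemma borel_measurable_if_dist_measurable:
  fixes f :: "'a \<Rightarrow> 'b::{metric_space, second_countable_topology}"
  assumes [measurable]: "\<And>u. (\<lambda>s. dist (f s) u) \<in> borel_measurable M"
  shows "f \<in> borel_measurable M"
proof (rule borel_measurableI)
  fix U :: "'b set" assume "open U"
  let ?F = "{ball u r | u r. ball u r \<subseteq> U}"
  obtain F where F: "F \<subseteq> ?F" "countable F" "\<Union>F = \<Union>?F"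
    by (rule Lindelof[of ?F]) auto
  have "\<Union>?F = U"
  proof
    show "U \<subseteq> \<Union>?F"
    proof
      fix x assume "x \<in> U"
      then obtain r where "r > 0" "ball x r \<subseteq> U"
        using \<open>open U\<close> by (auto elim: openE)
      then show "x \<in> \<Union>?F"
        by (intro UnionI[of "ball x r"]) auto
    qed
  qed auto
  then have "f -` U \<inter> space M = (\<Union>b\<in>F. f -` b \<inter> space M)"
    using F(3) by auto
  moreover have "f -` b \<inter> space M \<in> sets M" if b: "b \<in> F" for b
  proof -
    obtain u r where "b = ball u r" using b F(1) by blast
    then have "f -` b \<inter> space M = {s \<in> space M. dist (f s) u < r}"
      by (auto simp: dist_commute)
    then show ?thesis by simp
  qed
  ultimately show "f -` U \<inter> space M \<in> sets M"
    using F(2) by (simp only:) (rule sets.countable_UN'; blast)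
qed

subsection \<open>Representatives of \<open>L\<^sup>2\<close> classes\<close>

lemma borel_measurable_rep_l2 [measurable]: "rep_l2 u \<in> borel_measurable borel"
  using square_integrable_rep[of u] by (simp add: square_integrable_def)

lemma rep_l2_add: "AE x in lborel. rep_l2 (u + v) x = rep_l2 u x + rep_l2 v x"
  using rep_to_l2[OF square_integrable_add[OF square_integrable_rep[of u] square_integrable_rep[of v]]]
  by (simp add: to_l2_add square_integrable_rep)

lemma rep_l2_diff: "AE x in lborel. rep_l2 (u - v) x = rep_l2 u x - rep_l2 v x"
  using rep_to_l2[OF square_integrable_diff[OF square_integrable_rep[of u] square_integrable_rep[of v]]]
  by (simp add: to_l2_diff square_integrable_rep)

lemma rep_l2_scaleR: "AE x in lborel. rep_l2 (c *\<^sub>R u) x = c * rep_l2 u x"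
  using rep_to_l2[OF square_integrable_scale[OF square_integrable_rep[of u], of c]]
  by (simp add: to_l2_scale square_integrable_rep)

lemma rep_l2_0: "AE x in lborel. rep_l2 0 x = 0"
  using rep_to_l2[OF square_integrable_zero] by (simp add: to_l2_zero)

lemma norm_l2_eq: "(norm u)\<^sup>2 = (LINT x|lborel. (rep_l2 u x)\<^sup>2)"
  using norm_to_l2[OF square_integrable_rep[of u]] by (simp add: integral_nonneg_AE)

lemma norm_l2_mono:
  assumes "AE x in lborel. \<bar>rep_l2 u x\<bar> \<le> \<bar>rep_l2 v x\<bar>"
  shows "norm u \<le> norm v"
proof -
  have "(norm u)\<^sup>2 \<le> (norm v)\<^sup>2"
    unfolding norm_l2_eq
  proof (rule integral_mono_AE)
    show "AE x in lborel. (rep_l2 u x)\<^sup>2 \<le> (rep_l2 v x)\<^sup>2"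
      using assms by eventually_elim (simp add: abs_le_square_iff)
  qed (use square_integrable_rep[of u] square_integrable_rep[of v] in \<open>auto simp: square_integrable_def\<close>)
  then show ?thesis
    by (rule power2_le_imp_le) simp
qed

lemma square_integrable_bound:
  assumes "square_integrable g" "f \<in> borel_measurable borel" "AE x in lborel. \<bar>f x\<bar> \<le> \<bar>g x\<bar>"
  shows "square_integrable f"
proof -
  have "integrable lborel (\<lambda>x. (f x)\<^sup>2)"
  proof (rule Bochner_Integration.integrable_bound)
    show "integrable lborel (\<lambda>x. (g x)\<^sup>2)"
      using assms(1) by (simp add: square_integrable_def)
    show "AE x in lborel. norm ((f x)\<^sup>2) \<le> norm ((g x)\<^sup>2)"
      using assms(3) by eventually_elim (simp add: abs_le_square_iff)
  qed (use assms(2) in measurable)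
  then show ?thesis
    using assms(2) by (simp add: square_integrable_def)
qed

subsection \<open>Time slices\<close>

lemma AE_lborel_section:
  fixes P :: "'a::euclidean_space \<times> 'b::euclidean_space \<Rightarrow> bool"
  assumes "AE z in lborel. P z"
  shows "AE s in lborel. AE x in lborel. P (s, x)"
  by (rule lborel_pair.AE_pair) (unfold lborel_prod, rule assms)

lemma AE_square_integrable_section:
  "AE s in lborel. square_integrable (\<lambda>x. indicator {0<..<l::real} x * rep_l2 (F :: (real \<times> real) l2) (s, x))"
proof -
  have "integrable (lborel \<Otimes>\<^sub>M lborel) (\<lambda>z. (rep_l2 F z)\<^sup>2)"
    using square_integrable_rep[of F] by (simp add: lborel_prod square_integrable_def)
  from lborel_pair.AE_integrable_fst'[OF this] show ?thesis
  proof eventually_elim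
    case (elim s)
    have "(\<lambda>x. rep_l2 F (s, x)) \<in> borel_measurable borel"
      by measurable
    moreover from this elim have "square_integrable (\<lambda>x. rep_l2 F (s, x))"
      by (simp add: square_integrable_def)
    ultimately show ?case
      by (elim square_integrable_bound) (auto simp: indicator_def)
  qed
qed

text \<open>By Fubini the chosen representatives add up on almost every section. At the exceptional
  times a section may fail to be square-integrable, and \<open>to_l2\<close> then returns its
  default \<open>0\<close>.\<close>

lemma slice_add: "AE s in lborel. slice l (F + G) s = slice l F s + slice l G s"
  using AE_lborel_section[OF rep_l2_add[of F G]]
    AE_square_integrable_section[of l F] AE_square_integrable_section[of l G]
    AE_square_integrable_section[of l "F + G"]
proof eventually_elim
  case (elim s)
  show ?case
    unfolding slice_def
    by (subst to_l2_add[symmetric, OF elim(2,3)],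
        subst to_l2_eq_iff[OF elim(4) square_integrable_add[OF elim(2,3)]])
       (use elim(1) in \<open>eventually_elim, simp add: distrib_left\<close>)
qed

lemma slice_scaleR: "AE s in lborel. slice l (c *\<^sub>R F) s = c *\<^sub>R slice l F s"
  using AE_lborel_section[OF rep_l2_scaleR[of c F]]
    AE_square_integrable_section[of l F] AE_square_integrable_section[of l "c *\<^sub>R F"]
proof eventually_elim
  case (elim s)
  show ?case
    unfolding slice_def
    by (subst to_l2_scale[symmetric, OF elim(2)],
        subst to_l2_eq_iff[OF elim(3) square_integrable_scale[OF elim(2)]])
       (use elim(1) in \<open>eventually_elim, simp\<close>)
qed

lemma slice_in_L2_on: "slice l F s \<in> L2_on {0<..<l}"
proof (cases "square_integrable (\<lambda>x. indicator {0<..<l} x * rep_l2 F (s, x))")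
  case True
  from rep_to_l2[OF this] show ?thesis
    by (auto simp: L2_on_def slice_def indicator_def elim: eventually_mono)
next
  case False
  then show ?thesis
    using rep_l2_0 by (auto simp: L2_on_def slice_def to_l2_def elim: eventually_mono)
qed

text \<open>The case distinction inside \<open>to_l2\<close> amounts to finiteness of a nonnegative
  parameter integral. Both the test and the resulting distance are therefore measurable in
  \<open>s\<close>.\<close>

lemma borel_measurable_slice [measurable]: "slice l F \<in> borel_measurable borel"
proof (rule borel_measurable_if_dist_measurable)
  fix u :: "real l2"
  let ?f = "\<lambda>s x. indicator {0<..<l} x * rep_l2 F (s, x)"
  have [measurable]: "(\<lambda>z. rep_l2 F z) \<in> borel_measurable (borel \<Otimes>\<^sub>M borel)"
    by (simp add: borel_prod)
  have sq: "square_integrable (?f s) \<longleftrightarrow> (\<integral>\<^sup>+x. ennreal ((?f s x)\<^sup>2) \<partial>lborel) < \<infinity>" for s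
  proof
    assume "square_integrable (?f s)"
    from norm_to_l2_ennreal[OF this] show "(\<integral>\<^sup>+x. ennreal ((?f s x)\<^sup>2) \<partial>lborel) < \<infinity>"
      by simp
  qed (rule square_integrableI_nn, measurable)
  \<comment> \<open>The branch \<open>norm u\<close> is the distance from \<open>u\<close> to the
    default class \<open>0\<close>.\<close>
  have "dist (slice l F s) u = (if (\<integral>\<^sup>+x. ennreal ((?f s x)\<^sup>2) \<partial>lborel) < \<infinity>
      then sqrt (LINT x|lborel. (?f s x - rep_l2 u x)\<^sup>2) else norm u)" for s
  proof (cases "square_integrable (?f s)")
    case True
    then have "norm (slice l F s - to_l2 (rep_l2 u)) = sqrt (LINT x|lborel. (?f s x - rep_l2 u x)\<^sup>2)"
      unfolding slice_def
      by (subst to_l2_diff[symmetric])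
         (simp_all add: norm_to_l2 square_integrable_diff square_integrable_rep)
    with True show ?thesis
      using sq[of s] by (simp add: dist_norm)
  next
    case False
    then show ?thesis
      using sq[of s] by (simp add: slice_def to_l2_def dist_norm)
  qed
  then have "(\<lambda>s. dist (slice l F s) u) = (\<lambda>s. if (\<integral>\<^sup>+x. ennreal ((?f s x)\<^sup>2) \<partial>lborel) < \<infinity>
      then sqrt (LINT x|lborel. (?f s x - rep_l2 u x)\<^sup>2) else norm u)"
    by (rule ext)
  also have "\<dots> \<in> borel_measurable borel"
    by measurable
  finally show "(\<lambda>s. dist (slice l F s) u) \<in> borel_measurable borel" .
qed

text \<open>Fubini turns the integral over all sections into \<open>(norm F)\<^sup>2\<close>; the
  cut-off to the interval can only decrease it.\<close>

lemma slice_norm_square: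
  "integrable lborel (\<lambda>s. (norm (slice l F s))\<^sup>2)"
  "(LINT s|lborel. (norm (slice l F s))\<^sup>2) \<le> (norm F)\<^sup>2"
proof -
  let ?f = "\<lambda>s x. indicator {0<..<l} x * rep_l2 F (s, x)"
  let ?N = "\<lambda>s. LINT x|lborel. (rep_l2 F (s, x))\<^sup>2"
  have int: "integrable (lborel \<Otimes>\<^sub>M lborel) (\<lambda>z. (rep_l2 F z)\<^sup>2)"
    using square_integrable_rep[of F] by (simp add: lborel_prod square_integrable_def)
  have N: "integrable lborel ?N"
    using lborel_pair.integrable_fst'[OF int] .
  have le: "AE s in lborel. (norm (slice l F s))\<^sup>2 \<le> ?N s"
    using AE_square_integrable_section[of l F] lborel_pair.AE_integrable_fst'[OF int]
  proof eventually_elim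
    case (elim s)
    have "(norm (slice l F s))\<^sup>2 = (LINT x|lborel. (?f s x)\<^sup>2)"
      using elim(1) by (simp add: slice_def norm_to_l2 integral_nonneg_AE)
    also have "\<dots> \<le> ?N s"
      using elim by (intro integral_mono) (auto simp: square_integrable_def indicator_def)
    finally show ?case .
  qed
  show 1: "integrable lborel (\<lambda>s. (norm (slice l F s))\<^sup>2)"
  proof (rule Bochner_Integration.integrable_bound[OF N])
    show "AE s in lborel. norm ((norm (slice l F s))\<^sup>2) \<le> norm (?N s)"
      using le by eventually_elim simp
  qed measurable
  have "(LINT s|lborel. (norm (slice l F s))\<^sup>2) \<le> (LINT s|lborel. ?N s)"
    using le by (intro integral_mono_AE 1 N)
  also have "\<dots> = (norm F)\<^sup>2"
    using lborel_pair.integral_fst'[OF int] by (simp add: norm_l2_eq lborel_prod)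
  finally show "(LINT s|lborel. (norm (slice l F s))\<^sup>2) \<le> (norm F)\<^sup>2" .
qed

subsection \<open>The Duhamel integral\<close>

lemma L2_on_diff:
  assumes "u \<in> L2_on \<Omega>" "v \<in> L2_on \<Omega>"
  shows "u - v \<in> L2_on \<Omega>"
  using assms rep_l2_diff[of u v] unfolding L2_on_def mem_Collect_eq
  by eventually_elim simp

lemma zero_in_HH1: "0 \<in> HH1 l"
proof -
  have "(LBINT x:{0<..<l}. rep_l2 0 x * \<phi> x) = 0" for \<phi>
    unfolding set_lebesgue_integral_def
    using rep_l2_0 by (intro integral_eq_zero_AE) (auto elim: eventually_mono)
  moreover have "boundary_values l 0 0 0"
    unfolding boundary_values_def using rep_l2_0
    by (intro exI[of _ "\<lambda>_. 0"]) (auto elim: eventually_mono)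
  ultimately show ?thesis
    using rep_l2_0
    by (auto simp: HH1_def H1_def zero_prod_def weak_derivative_def L2_on_def elim: eventually_mono)
qed

lemma forcing_in: "forcing l W s \<in> {0} \<times> LL2 l"
  by (simp add: forcing_def LL2_def slice_in_L2_on zero_prod_def)

lemma forcing_space_subset: "{0} \<times> LL2 l \<subseteq> H_en l"
  using zero_in_HH1 by (auto simp: H_en_def)

text \<open>With a vanishing first component, only differences in \<open>L2_on\<close> matter. This
  makes \<open>{0} \<times> LL2 l\<close> a suitable set \<open>Y\<close> for joint continuity of
  the group.\<close>

lemma forcing_space_diff:
  assumes "x \<in> {0} \<times> LL2 l" "y \<in> {0} \<times> LL2 l"
  shows "x - y \<in> H_en l"
  using assms zero_in_HH1 L2_on_diff by (auto simp: H_en_def LL2_def)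

lemma borel_measurable_forcing [measurable]: "forcing l W \<in> borel_measurable borel"
  unfolding forcing_def by measurable

lemma norm_forcing: "(norm (forcing l W s))\<^sup>2 = (norm (slice l (fst W) s))\<^sup>2 + (rep_l2 (snd W) s)\<^sup>2"
  by (simp add: forcing_def norm_Pair)

lemma forcing_add: "AE s in lborel. forcing l (V + W) s = forcing l V s + forcing l W s"
  using slice_add[of l "fst V" "fst W"] rep_l2_add[of "snd V" "snd W"]
  by eventually_elim (simp add: forcing_def)

lemma forcing_scaleR: "AE s in lborel. forcing l (c *\<^sub>R W) s = c *\<^sub>R forcing l W s"
  using slice_scaleR[of l c "fst W"] rep_l2_scaleR[of c "snd W"]
  by eventually_elim (simp add: forcing_def)

text \<open>Joint continuity gives Borel measurability of \<open>(t, x) \<mapsto> S t x\<close>, but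
  only on \<open>UNIV \<times> Y\<close>, since \<open>S\<close> is arbitrary outside
  \<open>X\<close>. The inner map takes its values there.\<close>

lemma borel_measurable_group_compose:
  fixes S :: "real \<Rightarrow> 'a::{real_normed_vector, second_countable_topology} \<Rightarrow> 'a"
  assumes "strongly_continuous_group X S"
    and "Y \<subseteq> X" "\<And>x y. x \<in> Y \<Longrightarrow> y \<in> Y \<Longrightarrow> x - y \<in> X"
    and [measurable]: "\<tau> \<in> borel_measurable M" "g \<in> borel_measurable M"
    and "\<And>s. g s \<in> Y"
  shows "(\<lambda>s. S (\<tau> s) (g s)) \<in> borel_measurable M"
proof -
  have S: "(\<lambda>(t, x). S t x) \<in> borel_measurable (restrict_space borel (UNIV \<times> Y))"
    by (intro borel_measurable_continuous_on_restrict
        strongly_continuous_group_jointly_continuous[OF assms(1-3)])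
  have "(\<lambda>s. (\<tau> s, g s)) \<in> measurable M (restrict_space borel (UNIV \<times> Y))"
    using assms(6) by (intro measurable_restrict_space2) auto
  from measurable_compose[OF this S] show ?thesis
    by simp
qed

text \<open>The quadratic bound is the one that integrates directly, without the Cauchy--Schwarz inequality.\<close>

lemma bounded_linear_if_quadratic_bound:
  assumes "\<And>x y. f (x + y) = f x + f y" "\<And>c x. f (c *\<^sub>R x) = c *\<^sub>R f x"
    and bound: "\<And>x. norm (f x) \<le> a + b * (norm x)\<^sup>2"
  shows "bounded_linear f"
proof (rule bounded_linear_intro[where K = "a + b"])
  fix x
  show "norm (f x) \<le> norm x * (a + b)"
  proof (cases "x = 0")
    case True
    then show ?thesis using assms(2)[of 0 0] by simp
  next
    case False
    \<comment> \<open>Homogeneity reduces the estimate to unit vectors, where the quadratic bound is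
      the constant \<open>a + b\<close>.\<close>
    then have "norm (f x) = norm x * norm (f (x /\<^sub>R norm x))"
      by (simp add: assms(2))
    also have "\<dots> \<le> norm x * (a + b * (norm (x /\<^sub>R norm x))\<^sup>2)"
      by (intro mult_left_mono bound) auto
    finally show ?thesis using False by simp
  qed
qed (use assms in auto)

text \<open>One integrable majorant of the integrand yields both its Bochner integrability and the
  quadratic bound. Linearity in the source survives integration because \<open>forcing\<close> is
  linear for almost every time.\<close>

lemma bounded_linear_duhamel:
  assumes S: "strongly_continuous_group (H_en l) S" and "0 \<le> T"
  shows "bounded_linear (\<lambda>W. LBINT s:{0..T}. S (T - s) (forcing l W s))"
proof -
  obtain K where "0 \<le> K" and
    K: "\<And>t x. \<bar>t\<bar> \<le> T \<Longrightarrow> x \<in> H_en l \<Longrightarrow> norm (S t x) \<le> K * norm x"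
    using strongly_continuous_group_locally_bounded[OF S, of T] by auto
  let ?h = "\<lambda>W s. indicat_real {0..T} s *\<^sub>R S (T - s) (forcing l W s)"
  \<comment> \<open>This comes from \<open>r \<le> 1 + r\<^sup>2\<close> for the norm
    \<open>r\<close> of the forcing. The constant is cut off to \<open>{0..T}\<close> to be
    integrable; the squares are integrable on the whole line.\<close>
  let ?w = "\<lambda>W s. K * (indicat_real {0..T} s + (norm (slice l (fst W) s))\<^sup>2 + (rep_l2 (snd W) s)\<^sup>2)"
  have in_H: "forcing l W s \<in> H_en l" for W s
    using forcing_in forcing_space_subset by blast
  have [measurable]: "(\<lambda>s. S (T - s) (forcing l W s)) \<in> borel_measurable borel" for W
    by (rule borel_measurable_group_compose[OF S forcing_space_subset forcing_space_diff])
       (auto intro: forcing_in)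
  have G: "integrable lborel (\<lambda>s. (rep_l2 (snd W) s)\<^sup>2)" for W :: wave_source
    using square_integrable_rep[of "snd W"] by (simp add: square_integrable_def)
  have w: "integrable lborel (?w W)" for W
    by (intro integrable_mult_right Bochner_Integration.integrable_add integrable_real_indicator
        G slice_norm_square(1)) (auto simp: emeasure_lborel_Icc_eq)
  have h_le: "norm (?h W s) \<le> ?w W s" for W s
  proof (cases "s \<in> {0..T}")
    case True
    then have "norm (?h W s) \<le> K * norm (forcing l W s)"
      using K[OF _ in_H, of "T - s"] by simp
    also have "norm (forcing l W s) \<le> 1 + (norm (forcing l W s))\<^sup>2"
      using sum_squares_bound[of 1 "norm (forcing l W s)", simplified]
        norm_ge_zero[of "forcing l W s"] by argo
    finally show ?thesis
      using True \<open>0 \<le> K\<close> by (simp add: norm_forcing mult_left_mono add.assoc)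
  qed (use \<open>0 \<le> K\<close> in auto)
  have h: "integrable lborel (?h W)" for W
  proof (rule Bochner_Integration.integrable_bound[OF w])
    show "AE s in lborel. norm (?h W s) \<le> norm (?w W s)"
      by (intro AE_I2 order_trans[OF h_le]) (simp only: real_norm_def abs_ge_self)
  qed measurable
  have S_lin: "S t (c *\<^sub>R x + d *\<^sub>R y) = c *\<^sub>R S t x + d *\<^sub>R S t y"
    if "x \<in> H_en l" "y \<in> H_en l" for t c d x y
    using S that unfolding strongly_continuous_group_def by blast
  have "bounded_linear (\<lambda>W. integral\<^sup>L lborel (?h W))"
  proof (rule bounded_linear_if_quadratic_bound)
    fix V W :: wave_source
    have "integral\<^sup>L lborel (?h (V + W)) = (LINT s|lborel. ?h V s + ?h W s)"
    proof (rule integral_cong_AE)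
      show "AE s in lborel. ?h (V + W) s = ?h V s + ?h W s"
        using forcing_add[of l V W]
      proof eventually_elim
        case (elim s)
        then show ?case
          using S_lin[OF in_H in_H, of "T - s" 1 V s 1 W s] by (simp add: scaleR_add_right)
      qed
    qed measurable
    also have "\<dots> = integral\<^sup>L lborel (?h V) + integral\<^sup>L lborel (?h W)"
      by (intro Bochner_Integration.integral_add h)
    finally show "integral\<^sup>L lborel (?h (V + W)) = integral\<^sup>L lborel (?h V) + integral\<^sup>L lborel (?h W)" .
  next
    fix c and W :: wave_source
    have "integral\<^sup>L lborel (?h (c *\<^sub>R W)) = (LINT s|lborel. c *\<^sub>R ?h W s)"
    proof (rule integral_cong_AE)
      show "AE s in lborel. ?h (c *\<^sub>R W) s = c *\<^sub>R ?h W s"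
        using forcing_scaleR[of l c W]
      proof eventually_elim
        case (elim s)
        then show ?case
          using S_lin[OF in_H in_H, of "T - s" c W s 0 W s] by simp
      qed
    qed measurable
    also have "\<dots> = c *\<^sub>R integral\<^sup>L lborel (?h W)"
      by (rule integral_scaleR_right)
    finally show "integral\<^sup>L lborel (?h (c *\<^sub>R W)) = c *\<^sub>R integral\<^sup>L lborel (?h W)" .
  next
    fix W :: wave_source
    have "norm (integral\<^sup>L lborel (?h W)) \<le> (LINT s|lborel. norm (?h W s))"
      by (rule integral_norm_bound)
    also have "\<dots> \<le> (LINT s|lborel. ?w W s)"
      using h_le by (intro integral_mono w integrable_norm h) auto
    also have "\<dots> = K * (T + (LINT s|lborel. (norm (slice l (fst W) s))\<^sup>2) + (norm (snd W))\<^sup>2)"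
      using G[of W] slice_norm_square(1)[of l "fst W"] \<open>0 \<le> T\<close>
      by (simp add: norm_l2_eq)
    also have "\<dots> \<le> K * (T + (norm (fst W))\<^sup>2 + (norm (snd W))\<^sup>2)"
      using \<open>0 \<le> K\<close> slice_norm_square(2)[of l "fst W"] by (intro mult_left_mono) auto
    also have "\<dots> = K * T + K * (norm W)\<^sup>2"
      by (cases W) (simp add: norm_Pair algebra_simps)
    finally show "norm (integral\<^sup>L lborel (?h W)) \<le> K * T + K * (norm W)\<^sup>2" .
  qed
  then show ?thesis
    by (simp add: set_lebesgue_integral_def)
qed

text \<open>The free evolution of the initial data is the constant part, Duhamel's integral the
  linear part. This is the interface between the wave equation and the minimization
  argument.\<close>

lemma displacement_affine:
  assumes "strongly_continuous_group (H_en l) S" "0 \<le> T"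
  shows "\<exists>L. bounded_linear L \<and> (\<forall>W. displacement l S Z0 W T = displacement l S Z0 0 T + L W)"
proof -
  define D where "D W = (LBINT s:{0..T}. S (T - s) (forcing l W s))" for W
  have D: "bounded_linear D"
    unfolding D_def using assms by (rule bounded_linear_duhamel)
  define P where "P z = h1_to_l2 (fst z)" for z :: energy_state
  \<comment> \<open>\<open>P\<close> discards the weak derivative and the velocity; written through
    projections it is visibly bounded and linear.\<close>
  have "P = (\<lambda>z. (fst (fst (fst z)), snd (fst z)))"
    by (auto simp: P_def h1_to_l2_def fun_eq_iff split: prod.splits)
  then have P: "bounded_linear P"
    by (auto intro!: bounded_linear_Pair bounded_linear_fst_comp bounded_linear_snd_comp
        bounded_linear_fst bounded_linear_snd bounded_linear_ident)
  have disp: "displacement l S Z0 W T = P (S T Z0) + P (D W)" for W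
    using linear_add[OF bounded_linear.linear[OF P], of "S T Z0" "D W"]
    by (simp add: displacement_def mild_solution_def D_def P_def)
  show ?thesis
  proof (intro exI conjI allI)
    show "bounded_linear (\<lambda>W. P (D W))"
      using P D by (rule bounded_linear_compose)
    show "displacement l S Z0 W T = displacement l S Z0 0 T + P (D W)" for W
      by (simp add: disp linear_0[OF bounded_linear.linear[OF D]] linear_0[OF bounded_linear.linear[OF P]])
  qed
qed

subsection \<open>Box constraints in \<open>L\<^sup>2\<close>\<close>

text \<open>The common form of both source constraints, kept generic in the dimension so that each
  property is proved once.\<close>

definition L2_between :: "'a::euclidean_space set \<Rightarrow> real \<Rightarrow> real \<Rightarrow> 'a l2 set" where
  "L2_between \<Omega> a b = {u \<in> L2_on \<Omega>. AE x in lborel. x \<in> \<Omega> \<longrightarrow> a \<le> rep_l2 u x \<and> rep_l2 u x \<le> b}"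

lemma admissible_eq:
  "admissible T l Fmin Fmax Gmin Gmax =
    L2_between ({0<..<T} \<times> {0<..<l}) Fmin Fmax \<times> L2_between {0<..<T} Gmin Gmax"
  by (auto simp: admissible_def LL2_T_def L2_between_def)

lemma convex_L2_between: "convex (L2_between \<Omega> a b)"
proof (rule convexI)
  fix u v and s t :: real
  assume uv: "u \<in> L2_between \<Omega> a b" "v \<in> L2_between \<Omega> a b" and st: "0 \<le> s" "0 \<le> t" "s + t = 1"
  have rep: "AE x in lborel. rep_l2 (s *\<^sub>R u + t *\<^sub>R v) x = s * rep_l2 u x + t * rep_l2 v x"
    using rep_l2_add[of "s *\<^sub>R u" "t *\<^sub>R v"] rep_l2_scaleR[of s u] rep_l2_scaleR[of t v]
    by eventually_elim simp
  have u: "AE x in lborel. x \<notin> \<Omega> \<longrightarrow> rep_l2 u x = 0"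
      "AE x in lborel. x \<in> \<Omega> \<longrightarrow> a \<le> rep_l2 u x \<and> rep_l2 u x \<le> b"
    and v: "AE x in lborel. x \<notin> \<Omega> \<longrightarrow> rep_l2 v x = 0"
      "AE x in lborel. x \<in> \<Omega> \<longrightarrow> a \<le> rep_l2 v x \<and> rep_l2 v x \<le> b"
    using uv by (auto simp: L2_between_def L2_on_def)
  have "AE x in lborel. x \<notin> \<Omega> \<longrightarrow> rep_l2 (s *\<^sub>R u + t *\<^sub>R v) x = 0"
    using rep u(1) v(1) by eventually_elim simp
  moreover have "AE x in lborel. x \<in> \<Omega> \<longrightarrow>
      a \<le> rep_l2 (s *\<^sub>R u + t *\<^sub>R v) x \<and> rep_l2 (s *\<^sub>R u + t *\<^sub>R v) x \<le> b"
    using rep u(2) v(2)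
  proof eventually_elim
    case (elim x)
    show ?case
    proof
      assume "x \<in> \<Omega>"
      with elim have "rep_l2 u x \<in> {a..b}" "rep_l2 v x \<in> {a..b}" by auto
      from convexD[OF convex_real_interval(5) this st]
      show "a \<le> rep_l2 (s *\<^sub>R u + t *\<^sub>R v) x \<and> rep_l2 (s *\<^sub>R u + t *\<^sub>R v) x \<le> b"
        using elim(1) by simp
    qed
  qed
  ultimately show "s *\<^sub>R u + t *\<^sub>R v \<in> L2_between \<Omega> a b"
    by (simp add: L2_between_def L2_on_def)
qed

context
  fixes \<Omega> :: "'a::euclidean_space set" and a b :: real
  assumes \<Omega>: "\<Omega> \<in> sets borel" "emeasure lborel \<Omega> < \<infinity>"
begin

lemma square_integrable_const_indicator: "square_integrable (\<lambda>x. c * indicat_real \<Omega> x)"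
  by (intro square_integrable_scale square_integrable_indicator \<Omega>)

lemma bounded_L2_between: "bounded (L2_between \<Omega> a b)"
  unfolding bounded_iff
proof (intro exI ballI)
  fix u assume u: "u \<in> L2_between \<Omega> a b"
  let ?c = "max \<bar>a\<bar> \<bar>b\<bar>"
  show "norm u \<le> norm (to_l2 (\<lambda>x. ?c * indicat_real \<Omega> x))"
  proof (rule norm_l2_mono)
    have "AE x in lborel. x \<notin> \<Omega> \<longrightarrow> rep_l2 u x = 0"
      "AE x in lborel. x \<in> \<Omega> \<longrightarrow> a \<le> rep_l2 u x \<and> rep_l2 u x \<le> b"
      using u by (auto simp: L2_between_def L2_on_def)
    with rep_to_l2[OF square_integrable_const_indicator[of ?c]]
    show "AE x in lborel. \<bar>rep_l2 u x\<bar> \<le> \<bar>rep_l2 (to_l2 (\<lambda>x. ?c * indicat_real \<Omega> x)) x\<bar>"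
    proof eventually_elim
      case (elim x)
      then show ?case by (cases "x \<in> \<Omega>") (auto simp: max_def)
    qed
  qed
qed

text \<open>Truncating \<open>u\<close> to the interval from \<open>a\<close> to \<open>b\<close> on
  \<open>\<Omega>\<close>, and to \<open>0\<close> outside, is optimal at almost every point, hence
  in norm. It yields nonemptiness and closedness of the box.\<close>

lemma L2_between_nearest_point:
  assumes "a \<le> b"
  shows "\<exists>v\<in>L2_between \<Omega> a b. \<forall>w\<in>L2_between \<Omega> a b. norm (u - v) \<le> norm (u - w)"
proof -
  note [measurable] = \<Omega>(1)
  let ?f = "\<lambda>x. indicat_real \<Omega> x * max a (min b (rep_l2 u x))"
  let ?c = "max \<bar>a\<bar> \<bar>b\<bar>"
  have "square_integrable ?f"
  proof (rule square_integrable_bound[OF square_integrable_const_indicator[of ?c]])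
    show "AE x in lborel. \<bar>?f x\<bar> \<le> \<bar>?c * indicat_real \<Omega> x\<bar>"
      by (rule AE_I2) (auto simp: indicator_def)
  qed measurable
  then have v: "AE x in lborel. rep_l2 (to_l2 ?f) x = ?f x"
    by (rule rep_to_l2)
  show ?thesis
  proof (intro bexI ballI)
    have "AE x in lborel. x \<notin> \<Omega> \<longrightarrow> rep_l2 (to_l2 ?f) x = 0"
      using v by eventually_elim simp
    moreover have "AE x in lborel. x \<in> \<Omega> \<longrightarrow> a \<le> rep_l2 (to_l2 ?f) x \<and> rep_l2 (to_l2 ?f) x \<le> b"
      using v by eventually_elim (use assms in auto)
    ultimately show "to_l2 ?f \<in> L2_between \<Omega> a b"
      by (simp add: L2_between_def L2_on_def)
  next
    fix w assume w: "w \<in> L2_between \<Omega> a b"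
    show "norm (u - to_l2 ?f) \<le> norm (u - w)"
    proof (rule norm_l2_mono)
      have "AE x in lborel. x \<notin> \<Omega> \<longrightarrow> rep_l2 w x = 0"
        "AE x in lborel. x \<in> \<Omega> \<longrightarrow> a \<le> rep_l2 w x \<and> rep_l2 w x \<le> b"
        using w by (auto simp: L2_between_def L2_on_def)
      with v rep_l2_diff[of u "to_l2 ?f"] rep_l2_diff[of u w]
      show "AE x in lborel. \<bar>rep_l2 (u - to_l2 ?f) x\<bar> \<le> \<bar>rep_l2 (u - w) x\<bar>"
      proof eventually_elim
        case (elim x)
        then show ?case by (cases "x \<in> \<Omega>") (auto simp: max_def min_def)
      qed
    qed
  qed
qed

lemma nonempty_L2_between: "a \<le> b \<Longrightarrow> L2_between \<Omega> a b \<noteq> {}"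
  using L2_between_nearest_point by blast

text \<open>A limit of members has distance zero from the box, so it coincides with its nearest
  point there.\<close>

lemma closed_L2_between:
  assumes "a \<le> b"
  shows "closed (L2_between \<Omega> a b)"
  unfolding closed_sequential_limits
proof (intro allI impI, elim conjE)
  fix w u assume w: "\<forall>n. w n \<in> L2_between \<Omega> a b" and lim: "w \<longlonglongrightarrow> u"
  obtain v where v: "v \<in> L2_between \<Omega> a b"
    "\<And>w. w \<in> L2_between \<Omega> a b \<Longrightarrow> norm (u - v) \<le> norm (u - w)"
    using L2_between_nearest_point[OF assms] by blast
  have "(\<lambda>n. norm (u - w n)) \<longlonglongrightarrow> norm (u - u)"
    by (intro tendsto_intros lim)
  then have "norm (u - v) \<le> norm (u - u)"
    by (rule LIMSEQ_le_const) (use v(2) w in auto)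
  with v(1) show "u \<in> L2_between \<Omega> a b" by simp
qed

end

subsection \<open>Existence and uniqueness of minimizers\<close>

theorem mainTheorem6:
  fixes T l Fmin Fmax Gmin Gmax :: real
    and S :: "real \<Rightarrow> energy_state \<Rightarrow> energy_state"
    and Y0 :: h1_state and Y1 Yd :: l2_state
  assumes "T > 0" and "l > 0"
    and "Fmin \<le> Fmax" and "Gmin \<le> Gmax"
    and "generates_group (H_en l) (wave_A l) S"
    and "(Y0, Y1) \<in> H_en l"
    and "Yd \<in> LL2 l"
  shows "(\<exists>W. solves_minimization (cost T l S (Y0, Y1) Yd) (admissible T l Fmin Fmax Gmin Gmax) W) \<and>
    (\<forall>V. V \<subseteq> admissible T l Fmin Fmax Gmin Gmax \<and> closed V \<and> convex V \<and>
      (\<forall>W\<in>V. \<forall>dW. dW \<noteq> 0 \<and> W + dW \<in> V \<longrightarrow>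
        (norm (displacement l S (Y0, Y1) (W + dW) T - displacement l S (Y0, Y1) W T))\<^sup>2 > 0)
      \<longrightarrow>
      (\<forall>W\<in>V. \<forall>W'\<in>V.
        solves_minimization (cost T l S (Y0, Y1) Yd) (admissible T l Fmin Fmax Gmin Gmax) W \<and>
        solves_minimization (cost T l S (Y0, Y1) Yd) (admissible T l Fmin Fmax Gmin Gmax) W'
        \<longrightarrow> W = W'))"
proof -
  let ?U = "admissible T l Fmin Fmax Gmin Gmax" and ?J = "cost T l S (Y0, Y1) Yd"
  let ?Y = "\<lambda>W. displacement l S (Y0, Y1) W T"
  have "strongly_continuous_group (H_en l) S"
    using assms(5) by (simp add: generates_group_def)
  then obtain L where L: "bounded_linear L" and Y: "\<And>W. ?Y W = ?Y 0 + L W"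
    using displacement_affine[of l S T "(Y0, Y1)"] assms(1) by auto
  note lin = bounded_linear.linear[OF L]
  define z where "z = ?Y 0 - Yd"
  have J: "?J W = 1 / 2 * (norm (z + L W))\<^sup>2" for W
  proof -
    have "?Y W - Yd = z + L W"
      using Y[of W] by (simp add: z_def)
    then show ?thesis by (simp add: cost_def)
  qed
  have fin: "emeasure lborel {0<..<T} < \<infinity>" "emeasure lborel ({0<..<T} \<times> {0<..<l}) < \<infinity>"
    by (intro emeasure_bounded_finite bounded_Times; simp)+
  have meas: "{0<..<T} \<times> {0<..<l} \<in> sets borel"
    by (intro borel_open open_Times) auto
  have bdd: "bdd_below (?J ` ?U)"
    by (rule bdd_belowI[of _ 0]) (auto simp: J)
  have "\<exists>W\<in>?U. ?J W = (INF W\<in>?U. ?J W)"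
  proof (rule quasiconvex_attains_INF)
    show "closed ?U" "bounded ?U" "?U \<noteq> {}"
      unfolding admissible_eq
      using assms(3,4) fin meas
      by (simp_all add: closed_Times bounded_Times closed_L2_between bounded_L2_between nonempty_L2_between)
    show "continuous_on ?U ?J"
      unfolding J[abs_def]
      by (intro continuous_intros bounded_linear.continuous_on[OF L])
    fix r
    \<comment> \<open>This covers negative \<open>r\<close> as well: the real \<open>sqrt\<close> is
      then negative, and both sides are false.\<close>
    have "?J W \<le> r \<longleftrightarrow> norm (z + L W) \<le> sqrt (2 * r)" for W
    proof -
      have "norm (z + L W) \<le> sqrt (2 * r) \<longleftrightarrow> sqrt ((norm (z + L W))\<^sup>2) \<le> sqrt (2 * r)"
        by simp
      also have "\<dots> \<longleftrightarrow> ?J W \<le> r"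
        unfolding real_sqrt_le_iff J by auto
      finally show ?thesis ..
    qed
    \<comment> \<open>The centre is \<open>- z\<close> because the distance from \<open>- z\<close>
      to \<open>L W\<close> is \<open>norm (z + L W)\<close>.\<close>
    then have "{W \<in> ?U. ?J W \<le> r} = ?U \<inter> L -` cball (- z) (sqrt (2 * r))"
      by (auto simp: dist_norm norm_minus_commute[of "- z"] add.commute)
    moreover have "convex ?U"
      by (simp add: admissible_eq convex_Times convex_L2_between)
    ultimately show "convex {W \<in> ?U. ?J W \<le> r}"
      by (simp add: convex_Int convex_linear_vimage[OF lin])
  qed (rule bdd)
  then have existence: "\<exists>W. solves_minimization ?J ?U W"
    by (auto simp: solves_minimization_def)
  have uniqueness: "W = W'" if V: "V \<subseteq> ?U" "convex V" "W \<in> V" "W' \<in> V"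
      and inj: "\<forall>W\<in>V. \<forall>dW. dW \<noteq> 0 \<and> W + dW \<in> V \<longrightarrow> (norm (?Y (W + dW) - ?Y W))\<^sup>2 > 0"
      and min: "solves_minimization ?J ?U W" "solves_minimization ?J ?U W'" for V W W'
  proof (rule ccontr)
    assume "W \<noteq> W'"
    then have "W' - W \<noteq> 0" "W + (W' - W) \<in> V"
      using V by auto
    then have "(norm (?Y (W + (W' - W)) - ?Y W))\<^sup>2 > 0"
      using inj V(3) by blast
    moreover have "?Y W' - ?Y W = L W' - L W"
      using Y[of W] Y[of W'] by simp
    ultimately have pos: "(norm (L W' - L W))\<^sup>2 > 0"
      by simp
    \<comment> \<open>Convexity of \<open>V\<close> makes the midpoint a competitor in the full
      admissible set.\<close>
    define M where "M = (1/2) *\<^sub>R W + (1/2) *\<^sub>R W'"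
    have "M \<in> ?U"
      unfolding M_def using V by (intro subsetD[OF V(1)] convexD[OF V(2)]) auto
    then have "(INF W\<in>?U. ?J W) \<le> ?J M"
      using bdd by (intro cINF_lower)
    \<comment> \<open>The offset \<open>z\<close> cancels in the difference term of the
      parallelogram identity. The factor \<open>1 / 8\<close> combines \<open>1 / 2\<close> from the
      cost with \<open>1 / 4\<close> from squaring the midpoint weight. Both minimizers attain the
      infimum, so \<open>M\<close> would fall strictly below it.\<close>
    moreover have "?J M = ?J W / 2 + ?J W' / 2 - (norm (L W' - L W))\<^sup>2 / 8"
    proof -
      have "z + L M = (1/2) *\<^sub>R ((z + L W) + (z + L W'))"
        unfolding M_def by (simp add: linear_add[OF lin] linear_scale[OF lin] scaleR_add_right scaleR_left_distrib[symmetric] algebra_simps)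
      then have "?J M = (norm ((z + L W) + (z + L W')))\<^sup>2 / 8"
        by (simp add: J power_divide)
      moreover have "(norm ((z + L W) + (z + L W')))\<^sup>2 + (norm (L W' - L W))\<^sup>2
          = 2 * (norm (z + L W))\<^sup>2 + 2 * (norm (z + L W'))\<^sup>2"
        by (simp add: power2_norm_eq_inner inner_diff_left inner_diff_right
            inner_add_left inner_add_right inner_commute)
      ultimately show ?thesis
        unfolding J by simp
    qed
    ultimately show False
      using min pos by (simp add: solves_minimization_def)
  qed
  show ?thesis
    by (intro conjI allI impI ballI existence, elim conjE, rule uniqueness)
qed

end
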